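(* Let $q>1$ be a real number and suppose that $q\in\overline{\mathcal U}$. Then: (i) $\overline{\mathcal U_q}=\mathcal V_q$, where $\overline{\mathcal U_q}$ denotes the topological closure of $\mathcal U_q$; (ii) $|\mathcal V_q\setminus\mathcal U_q|=\aleph_0$ and $\mathcal V_q\setminus\mathcal U_q$ is dense in $\mathcal V_q$; (iii) if $q\in\mathcal U$, then each element $x\in\mathcal V_q\setminus\mathcal U_q$ has exactly $2$ expansions in base $q$; (iv) if $q\in\overline{\mathcal U}\setminus\mathcal U$, then each element $x\in\mathcal V_q\setminus\mathcal U_q$ has exactly $\aleph_0$ expansions in base $q$.
   Context: Let $\mathbb N=\{1,2,\dots\}$. A sequence is an element of $\{0,1,2,\dots\}^{\mathbb N}$; it is called infinite if it has infinitely many nonzero terms, and finite otherwise. Sequences are compared lexicographically. For a real $q>1$, let $\lceil q\rceil$ be the smallest integer $\ge q$ and let $J_q=[0,(\lceil q\rceil-1)/(q-1)]$. An expansion of a real number $x$ in base $q$ is a sequence $(c_i)$ of integers with $0\le c_i<q$ for all $i\ge1$ and $x=\sum_{i\ge1}c_iq^{-i}$. The quasi-greedy expansion $(a_i(x))$ of $x\in J_q\setminus\{0\}$ in base $q$ is its lexicographically largest infinite expansion (it exists); the quasi-greedy expansion of $0$ is $0^\infty$. Write $(\alpha_i)=(\alpha_i(q))$ for the quasi-greedy expansion of $1$ in base $q$; one has $\alpha_1=\lceil q\rceil-1$. For a digit $c\in\{0,\dots,\alpha_1\}$ put $\overline c=\alpha_1-c$, and $\overline{c_1c_2\ldots}=\overline{c_1}\,\overline{c_2}\ldots$.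 $\mathcal U$ is the set of real numbers $q>1$ for which $1$ has exactly one expansion in base $q$, and $\overline{\mathcal U}$ is its topological closure. For $q>1$, $\mathcal U_q$ is the set of real numbers $x$ having exactly one expansion in base $q$, and $$\mathcal V_q=\{x\in J_q:\ \overline{a_{n+1}(x)a_{n+2}(x)\ldots}\le\alpha_1\alpha_2\ldots\ \text{whenever } a_n(x)>0\}.$$ *)

theory Defs
  imports "HOL-Analysis.Analysis" "HOL-Library.Fun_Lexorder"
begin

text \<open>
  A sequence \<open>c\<^sub>1 c\<^sub>2 c\<^sub>3 \<dots>\<close> of nonnegative integers is encoded as a function \<open>c :: nat \<Rightarrow> nat\<close> whose
  value at \<open>i\<close> is the term \<open>c\<^sub>i\<^sub>+\<^sub>1\<close>. This shift avoids an unused entry at index \<open>0\<close>, which would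
  spoil the counting of expansions.
\<close>

definition infinite_seq :: "(nat \<Rightarrow> nat) \<Rightarrow> bool" where
  "infinite_seq c \<longleftrightarrow> infinite {i. c i \<noteq> 0}"

definition lex_le :: "(nat \<Rightarrow> nat) \<Rightarrow> (nat \<Rightarrow> nat) \<Rightarrow> bool" where
  "lex_le c d \<longleftrightarrow> less_fun c d \<or> c = d"

definition expansion :: "real \<Rightarrow> real \<Rightarrow> (nat \<Rightarrow> nat) \<Rightarrow> bool" where
  "expansion q x c \<longleftrightarrow> (\<forall>i. real (c i) < q) \<and> (\<lambda>i. real (c i) / q ^ Suc i) sums x"

definition J :: "real \<Rightarrow> real set" where
  "J q = {0..(real_of_int \<lceil>q\<rceil> - 1) / (q - 1)}"

text \<open>Only meaningful for \<open>q > 1\<close> and \<open>x \<in> J q\<close>; elsewhere the value is unspecified.\<close>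

definition quasi_greedy :: "real \<Rightarrow> real \<Rightarrow> nat \<Rightarrow> nat" where
  "quasi_greedy q x =
     (if x = 0 then (\<lambda>_. 0)
      else (THE a. expansion q x a \<and> infinite_seq a \<and>
                   (\<forall>c. expansion q x c \<and> infinite_seq c \<longrightarrow> lex_le c a)))"

abbreviation \<alpha> :: "real \<Rightarrow> nat \<Rightarrow> nat" where
  "\<alpha> q \<equiv> quasi_greedy q 1"

text \<open>
  \<open>\<alpha> q 0\<close> is the digit \<open>\<alpha>\<^sub>1\<close>. The subtraction on \<open>nat\<close> does not truncate on digits, since an integer
  smaller than \<open>q\<close> is at most \<open>\<alpha>\<^sub>1 = \<lceil>q\<rceil> - 1\<close>.
\<close>

definition reflection :: "real \<Rightarrow> (nat \<Rightarrow> nat) \<Rightarrow> nat \<Rightarrow> nat" where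
  "reflection q c = (\<lambda>i. \<alpha> q 0 - c i)"

definition univoque_bases :: "real set" where
  "univoque_bases = {q. q > 1 \<and> (\<exists>!c. expansion q 1 c)}"

definition univoque_set :: "real \<Rightarrow> real set" where
  "univoque_set q = {x. \<exists>!c. expansion q x c}"

definition V_set :: "real \<Rightarrow> real set" where
  "V_set q = {x \<in> J q. \<forall>n. quasi_greedy q x n > 0 \<longrightarrow>
              lex_le (reflection q (\<lambda>i. quasi_greedy q x (Suc n + i))) (\<alpha> q)}"

end

theory Submission
  imports Defs
begin

text \<open>
  Write \<open>\<alpha>\<close> for the quasi-greedy expansion of \<open>1\<close> and \<open>M\<close> for the maximal digit. Call a digit sequence
  \<^emph>\<open>admissible\<close> if what follows a digit below \<open>M\<close> is at most \<open>\<alpha>\<close>, and the reflection of what follows a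
  positive digit is at most \<open>\<alpha>\<close>. Then \<open>V_set q\<close> consists of the values of the admissible sequences
  (\<open>V_set_eq\<close>), hence is closed by compactness, and \<open>univoque_set q\<close> consists of the values of the
  sequences for which all these inequalities are strict.

  Everything about expansions comes from one comparison. If \<open>c\<close> is admissible and \<open>d > c\<close> has the same
  value, then at the first difference the tail of \<open>c\<close> has value at most \<open>1\<close>, so it has value exactly \<open>1\<close>:
  this tail is \<open>\<alpha>\<close>, the digit of \<open>d\<close> is larger by one, and the tail of \<open>d\<close> is zero. By reflection the same holds
  below \<open>c\<close>. So, besides \<open>c\<close>, the value of \<open>c\<close> has exactly one expansion for each position at which one
  of the inequalities is an equality (\<open>expansions_of_admissible\<close>). If \<open>1\<close> has only one expansion, such a
  position is unique if it exists, and each number in \<open>V_set q - univoque_set q\<close> has two expansions;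
  otherwise \<open>\<alpha>\<close> is periodic, the position recurs, and there are countably infinitely many.
  A sequence with an equality has the tail \<open>\<alpha>\<close> or its reflection, which makes
  \<open>V_set q - univoque_set q\<close> countable.

  The hypothesis that \<open>q\<close> lies in the closure of \<open>univoque_bases\<close> enters through a single fact,
  \<open>closure_univoque_bases_strict\<close>: \<open>\<alpha>\<close> satisfies its lower inequalities strictly. The weak inequalities
  pass to the limit from the univoque bases near \<open>q\<close>; an equality would force \<open>\<alpha>\<close> to be periodic, with a
  period made of a block and its reflection, and the expansion of \<open>1\<close> in a nearby univoque base, which begins
  with that period, would violate its own strict inequalities.

  Given this, an infinite admissible sequence without equality in its lower conditions can be cut at
  arbitrarily large \<^emph>\<open>good\<close> positions, where the last digit is lowered and \<open>\<alpha>\<close> is appended; the result is admissible with an equality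
  (\<open>good_exists\<close>, \<open>cut_admissible\<close>). Up to reflection, and with a separate argument at \<open>0\<close>, this shows that
  every point of \<open>V_set q\<close> is a limit point of \<open>V_set q - univoque_set q\<close>. This gives density, and it makes
  \<open>V_set q\<close> a closed set without isolated points. Baire's theorem allows a countable set to be removed from
  it without losing density, so \<open>univoque_set q\<close> is dense in \<open>V_set q\<close>.
\<close>

section \<open>Digit sequences, shifts and reflections\<close>

text \<open>
  The shift that drops the first \<open>n\<close> terms. For a sequence \<open>c\<^sub>1 c\<^sub>2 \<dots>\<close> stored from index \<open>0\<close>, the term at
  index \<open>n\<close> is followed by \<open>tail (Suc n) c\<close>; the lexicographic conditions are therefore stated with
  \<open>Suc n\<close>.
\<close>

definition tail :: "nat \<Rightarrow> (nat \<Rightarrow> nat) \<Rightarrow> nat \<Rightarrow> nat" where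
  "tail n c = (\<lambda>i. c (n + i))"

text \<open>
  Sequences over the alphabet \<open>{0, \<dots>, N}\<close>.
\<close>

definition digits :: "nat \<Rightarrow> (nat \<Rightarrow> nat) \<Rightarrow> bool" where
  "digits N c \<longleftrightarrow> (\<forall>i. c i \<le> N)"

text \<open>
  The reflection of a sequence over \<open>{0, \<dots>, N}\<close>. The maximal digit is a parameter here, so that
  nothing needs to be known about \<open>\<alpha> q\<close>; \<open>reflection q\<close> agrees with \<open>flip (maxdig q)\<close>
  by \<open>reflection_eq\<close> below.
\<close>

definition flip :: "nat \<Rightarrow> (nat \<Rightarrow> nat) \<Rightarrow> nat \<Rightarrow> nat" where
  "flip N c = (\<lambda>i. N - c i)"

lemma tail_apply [simp]: "tail n c i = c (n + i)"
  by (simp add: tail_def)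

lemma tail_tail [simp]: "tail m (tail n c) = tail (n + m) c"
  by (simp add: tail_def add.assoc)

lemma tail_0 [simp]: "tail 0 c = c"
  by (simp add: tail_def)

lemma flip_apply [simp]: "flip N c i = N - c i"
  by (simp add: flip_def)

lemma tail_flip [simp]: "tail n (flip N c) = flip N (tail n c)"
  by (simp add: tail_def flip_def)

lemma digitsD: "digits N c \<Longrightarrow> c i \<le> N"
  by (simp add: digits_def)

lemma digits_tail [simp, intro]: "digits N c \<Longrightarrow> digits N (tail n c)"
  by (simp add: digits_def)

lemma digits_flip [simp, intro]: "digits N (flip N c)"
  by (simp add: digits_def)

lemma flip_flip [simp]: "digits N c \<Longrightarrow> flip N (flip N c) = c"
  by (auto simp: digits_def flip_def)

text \<open>
  Reflection reverses the lexicographic order; this is what lets each statement about lower bounds be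
  deduced from its counterpart about upper bounds.
\<close>

lemma flip_less:
  assumes "digits N c" "digits N d"
  shows "less_fun (flip N d) (flip N c) \<longleftrightarrow> less_fun c d"
proof -
  have "(N - d k < N - c k) = (c k < d k)" "(N - d k = N - c k) = (c k = d k)" for k
    using digitsD[OF assms(1), of k] digitsD[OF assms(2), of k] by auto
  then show ?thesis
    by (simp add: less_fun_def)
qed

lemma first_difference:
  fixes c d :: "nat \<Rightarrow> nat"
  assumes "c \<noteq> d"
  obtains k where "c k \<noteq> d k" "\<And>j. j < k \<Longrightarrow> c j = d j"
proof -
  have "\<exists>k. c k \<noteq> d k" using assms by auto
  then show ?thesis
    using that[of "LEAST k. c k \<noteq> d k"] not_less_Least[of _ "\<lambda>k. c k \<noteq> d k"]
    by (metis (mono_tags, lifting) LeastI_ex)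
qed

lemma less_fun_linear:
  fixes c d :: "nat \<Rightarrow> nat"
  shows "less_fun c d \<or> c = d \<or> less_fun d c"
proof (cases "c = d")
  case False
  then obtain k where "c k \<noteq> d k" "\<And>j. j < k \<Longrightarrow> c j = d j"
    using first_difference by metis
  then show ?thesis
    unfolding less_fun_def by (metis linorder_neqE_nat)
qed auto

lemma lex_le_iff_not_less: "lex_le c d \<longleftrightarrow> \<not> less_fun d c"
  unfolding lex_le_def by (metis less_fun_asym less_fun_irrefl less_fun_linear)

lemma lex_le_antisym: "lex_le c d \<Longrightarrow> lex_le d c \<Longrightarrow> c = d"
  unfolding lex_le_def using less_fun_asym by blast

lemma less_lex_le_trans: "less_fun c d \<Longrightarrow> lex_le d e \<Longrightarrow> less_fun c e"
  unfolding lex_le_def using less_fun_trans by blast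

lemma infinite_seq_tail [simp]: "infinite_seq (tail n c) \<longleftrightarrow> infinite_seq c"
proof -
  have "infinite_seq c \<longleftrightarrow> (\<forall>m. \<exists>k\<ge>m. c k \<noteq> 0)" for c
    by (simp add: infinite_seq_def infinite_nat_iff_unbounded_le)
  moreover have "(\<forall>m. \<exists>k\<ge>m. c (n + k) \<noteq> 0) \<longleftrightarrow> (\<forall>m. \<exists>k\<ge>m. c k \<noteq> 0)"
  proof (intro iffI allI)
    fix m assume a: "\<forall>m. \<exists>k\<ge>m. c k \<noteq> 0"
    then obtain k where "k \<ge> n + m" "c k \<noteq> 0" by blast
    then show "\<exists>k\<ge>m. c (n + k) \<noteq> 0"
      by (intro exI[of _ "k - n"]) auto
  next
    fix m assume a: "\<forall>m. \<exists>k\<ge>m. c (n + k) \<noteq> 0"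
    then show "\<exists>k\<ge>m. c k \<noteq> 0" by (meson trans_le_add2)
  qed
  ultimately show ?thesis by simp
qed

lemma infinite_seqD: "infinite_seq c \<Longrightarrow> \<exists>k\<ge>n. c k > 0"
  by (auto simp: infinite_seq_def infinite_nat_iff_unbounded_le)

lemma not_infinite_seqD:
  assumes "\<not> infinite_seq c" "c \<noteq> (\<lambda>_. 0)"
  obtains n where "c n > 0" "tail (Suc n) c = (\<lambda>_. 0)"
proof -
  have fin: "finite {i. c i \<noteq> 0}" and ne: "{i. c i \<noteq> 0} \<noteq> {}"
    using assms by (auto simp: infinite_seq_def)
  let ?n = "Max {i. c i \<noteq> 0}"
  have "c ?n \<noteq> 0" using Max_in[OF fin ne] by simp
  moreover have "c (Suc ?n + i) = 0" for i
    using Max_ge[OF fin, of "Suc ?n + i"] by auto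
  ultimately have "c ?n > 0" "tail (Suc ?n) c = (\<lambda>_. 0)" by (auto simp del: add_Suc)
  then show ?thesis by (rule that)
qed

section \<open>Values of digit sequences\<close>

text \<open>
  The real number represented by a digit sequence in base \<open>q\<close>.
\<close>

definition val :: "real \<Rightarrow> (nat \<Rightarrow> nat) \<Rightarrow> real" where
  "val q c = (\<Sum>i. real (c i) / q ^ Suc i)"

text \<open>
  The largest digit \<open>\<lceil>q\<rceil> - 1\<close> that is smaller than \<open>q\<close>.
\<close>

definition maxdig :: "real \<Rightarrow> nat" where
  "maxdig q = nat (\<lceil>q\<rceil> - 1)"

text \<open>
  Inside this locale \<open>M\<close> and \<open>v\<close> denote the maximal digit and the value in base \<open>q\<close>; further below,
  \<open>a1\<close> denotes the sequence \<open>\<alpha> q\<close>.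
\<close>

locale base =
  fixes q :: real
  assumes q_gt_1: "1 < q"
begin

abbreviation "M \<equiv> maxdig q"
abbreviation "v \<equiv> val q"

lemma M_bounds: "real M < q" "q \<le> real M + 1" "M \<ge> 1" "real_of_int \<lceil>q\<rceil> - 1 = real M"
proof -
  have "\<lceil>q\<rceil> \<ge> 2" using q_gt_1 by linarith
  then have "int M = \<lceil>q\<rceil> - 1" by (simp add: maxdig_def)
  then have M: "real M = real_of_int \<lceil>q\<rceil> - 1"
    by (metis of_int_1 of_int_diff of_int_of_nat_eq)
  then show "real M < q" "q \<le> real M + 1" "M \<ge> 1" "real_of_int \<lceil>q\<rceil> - 1 = real M"
    using q_gt_1 by linarith+
qed

lemma digit_less_iff: "real k < q \<longleftrightarrow> k \<le> M"
  using M_bounds by (metis le_less_trans less_Suc_eq_le less_le_trans of_nat_Suc of_nat_less_iff not_le add.commute of_nat_le_iff)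

lemma J_eq: "J q = {0..M / (q - 1)}"
  by (simp add: J_def M_bounds(4))

lemma one_le_J: "1 \<le> M / (q - 1)"
  using q_gt_1 M_bounds(2) by (simp add: field_simps)

lemma geometric_tail: "(\<lambda>i. real N / q ^ Suc i) sums (N / (q - 1))"
proof -
  have "(\<lambda>i. (1 / q) ^ i) sums (1 / (1 - 1 / q))"
    using q_gt_1 by (intro geometric_sums) auto
  then have "(\<lambda>i. (N / q) * (1 / q) ^ i) sums ((N / q) * (1 / (1 - 1 / q)))"
    by (rule sums_mult)
  moreover have "(N / q) * (1 / (1 - 1 / q)) = N / (q - 1)"
    using q_gt_1 by (simp add: field_simps)
  moreover have "(N / q) * (1 / q) ^ i = N / q ^ Suc i" for i
    by (simp add: power_one_over)
  ultimately show ?thesis by (simp only:)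
qed

lemma summable_val:
  assumes "digits N c"
  shows "summable (\<lambda>i. real (c i) / q ^ Suc i)"
proof (rule summable_comparison_test)
  show "summable (\<lambda>i. real N / q ^ Suc i)"
    using geometric_tail sums_summable by blast
  show "\<exists>n0. \<forall>n\<ge>n0. norm (real (c n) / q ^ Suc n) \<le> real N / q ^ Suc n"
    using digitsD[OF assms] q_gt_1 by (auto intro!: divide_right_mono)
qed

lemma val_sums: "digits N c \<Longrightarrow> (\<lambda>i. real (c i) / q ^ Suc i) sums v c"
  unfolding val_def using summable_val summable_sums by blast

lemma val_nonneg: "digits N c \<Longrightarrow> 0 \<le> v c"
  unfolding val_def using q_gt_1 by (intro suminf_nonneg summable_val) auto

lemma val_le: "digits N c \<Longrightarrow> v c \<le> N / (q - 1)"
  using q_gt_1 digitsD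
  by (intro sums_le[OF _ val_sums geometric_tail]) (auto intro!: divide_right_mono)

lemma val_const: "v (\<lambda>_. N) = N / (q - 1)"
  unfolding val_def using geometric_tail by (rule sums_unique[symmetric])

lemma val_zero [simp]: "v (\<lambda>_. 0) = 0"
  using val_const[of 0] by simp

lemma val_pos:
  assumes "digits N c" "c k > 0"
  shows "v c > 0"
  unfolding val_def
  by (rule suminf_pos2[OF summable_val[OF assms(1)], of k]) (use q_gt_1 assms(2) in auto)

lemma val_pos_infinite: "digits N c \<Longrightarrow> infinite_seq c \<Longrightarrow> v c > 0"
  using infinite_seqD val_pos by blast

lemma val_eq_0: "digits N c \<Longrightarrow> v c = 0 \<Longrightarrow> c = (\<lambda>_. 0)"
  using val_pos by (metis ext gr0I less_irrefl)

lemma val_flip: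
  assumes "digits N c"
  shows "v (flip N c) = N / (q - 1) - v c"
proof -
  have "(\<lambda>i. N / q ^ Suc i - c i / q ^ Suc i) sums (N / (q - 1) - v c)"
    by (intro sums_diff geometric_tail val_sums[OF assms])
  moreover have "N / q ^ Suc i - c i / q ^ Suc i = real (flip N c i) / q ^ Suc i" for i
    using digitsD[OF assms, of i] by (simp add: of_nat_diff diff_divide_distrib)
  ultimately have "(\<lambda>i. real (flip N c i) / q ^ Suc i) sums (N / (q - 1) - v c)"
    by simp
  then show ?thesis
    using val_sums[OF digits_flip] sums_unique2 by blast
qed

lemma val_prefix:
  assumes "digits N c"
  shows "v c = (\<Sum>i<n. c i / q ^ Suc i) + v (tail n c) / q ^ n"
proof -
  have "v c = (\<Sum>i. real (c (i + n)) / q ^ Suc (i + n)) + (\<Sum>i<n. c i / q ^ Suc i)"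
    unfolding val_def by (rule suminf_split_initial_segment[OF summable_val[OF assms]])
  also have "(\<lambda>i. real (c (i + n)) / q ^ Suc (i + n)) = (\<lambda>i. (c (n + i) / q ^ Suc i) / q ^ n)"
    by (simp add: power_add add.commute mult.assoc)
  also have "(\<Sum>i. (c (n + i) / q ^ Suc i) / q ^ n) = v (tail n c) / q ^ n"
    using suminf_divide[OF summable_val[OF digits_tail[OF assms, of n]], of "q ^ n"]
    by (simp add: val_def)
  finally show ?thesis by simp
qed

text \<open>
  Comparison of two values at an index \<open>k\<close> up to which the sequences agree. Almost every estimate below
  applies this at the first index at which two sequences differ.
\<close>

lemma val_split:
  assumes "digits N c" "digits N d" "\<And>j. j < k \<Longrightarrow> c j = d j"
  shows "v c - v d =
    (real (c k) - real (d k) + v (tail (Suc k) c) - v (tail (Suc k) d)) / q ^ Suc k"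
proof -
  have "(\<Sum>i<k. c i / q ^ Suc i) = (\<Sum>i<k. d i / q ^ Suc i)"
    using assms(3) by (intro sum.cong) auto
  then show ?thesis
    using val_prefix[OF assms(1), of "Suc k"] val_prefix[OF assms(2), of "Suc k"]
    by (simp add: diff_divide_distrib add_divide_distrib)
qed

lemma val_tail_Suc:
  assumes "digits N c"
  shows "v (tail (Suc n) c) = q * v (tail n c) - c n"
  using val_prefix[OF digits_tail[OF assms, of n], of 1] q_gt_1 by (simp add: field_simps)

lemma val_close:
  assumes "digits N c" "digits N d" "\<And>j. j < k \<Longrightarrow> c j = d j"
  shows "\<bar>v c - v d\<bar> \<le> N / (q - 1) / q ^ k"
proof -
  have "(\<Sum>i<k. c i / q ^ Suc i) = (\<Sum>i<k. d i / q ^ Suc i)"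
    using assms(3) by (intro sum.cong) auto
  then have "v c - v d = (v (tail k c) - v (tail k d)) / q ^ k"
    using val_prefix[OF assms(1), of k] val_prefix[OF assms(2), of k]
    by (simp add: diff_divide_distrib)
  moreover have "\<bar>v (tail k c) - v (tail k d)\<bar> \<le> N / (q - 1)"
    using val_nonneg[of N "tail k c"] val_nonneg[of N "tail k d"]
      val_le[of N "tail k c"] val_le[of N "tail k d"] assms by auto
  ultimately show ?thesis
    using q_gt_1 divide_right_mono[of "\<bar>v (tail k c) - v (tail k d)\<bar>" "N / (q - 1)" "q ^ k"]
    by (simp add: abs_divide)
qed

lemma expansion_iff: "expansion q x c \<longleftrightarrow> digits M c \<and> v c = x"
proof
  assume a: "expansion q x c"
  then have "digits M c" by (simp add: expansion_def digits_def digit_less_iff)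
  moreover have "v c = x"
    using a val_sums[OF calculation] sums_unique2 unfolding expansion_def by blast
  ultimately show "digits M c \<and> v c = x" by blast
next
  assume "digits M c \<and> v c = x"
  then show "expansion q x c"
    using val_sums by (auto simp: expansion_def digits_def digit_less_iff)
qed

lemma val_in_J: "digits M c \<Longrightarrow> v c \<in> J q"
  using val_nonneg val_le by (auto simp: J_eq)

end

section \<open>Quasi-greedy expansions\<close>

context base
begin

text \<open>
  Quasi-greedy sequences, described by values instead of a lexicographic maximum: infinite sequences
  in which the shift after each digit below \<open>M\<close> has value at most \<open>1\<close>. By \<open>quasi_greedy_val\<close> and
  \<open>quasigreedy_seq_exists\<close> these are the quasi-greedy expansions of the positive numbers in \<open>J q\<close>.
\<close>

definition quasigreedy_seq :: "(nat \<Rightarrow> nat) \<Rightarrow> bool" where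
  "quasigreedy_seq c \<longleftrightarrow> digits M c \<and> infinite_seq c \<and>
     (\<forall>n. c n < M \<longrightarrow> v (tail (Suc n) c) \<le> 1)"

lemma quasigreedy_seqD:
  assumes "quasigreedy_seq c"
  shows "digits M c" "infinite_seq c" "\<And>n. c n < M \<Longrightarrow> v (tail (Suc n) c) \<le> 1"
  using assms by (auto simp: quasigreedy_seq_def)

lemma quasigreedy_seq_largest:
  assumes "quasigreedy_seq a" "digits M c" "infinite_seq c" "v c = v a"
  shows "lex_le c a"
proof (rule ccontr)
  note a = quasigreedy_seqD[OF assms(1)]
  assume "\<not> lex_le c a"
  then obtain k where k: "a k < c k" "\<And>j. j < k \<Longrightarrow> a j = c j"
    unfolding lex_le_iff_not_less less_fun_def by blast
  have "a k < M" using k(1) digitsD[OF assms(2), of k] by simp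
  then have "v (tail (Suc k) a) \<le> 1" by (rule a(3))
  moreover have "v (tail (Suc k) c) > 0"
    using assms by (intro val_pos_infinite) auto
  ultimately have "real (a k) - real (c k) + v (tail (Suc k) a) - v (tail (Suc k) c) < 0"
    using k(1) by linarith
  then have "v a - v c < 0"
    using q_gt_1 by (subst val_split[OF a(1) assms(2) k(2)]) (auto simp: divide_less_0_iff)
  then show False using assms(4) by simp
qed

lemma quasi_greedy_val:
  assumes "quasigreedy_seq a"
  shows "quasi_greedy q (v a) = a"
proof -
  note a = quasigreedy_seqD[OF assms]
  have pos: "v a \<noteq> 0" using val_pos_infinite[OF a(1,2)] by simp
  have "(THE b. expansion q (v a) b \<and> infinite_seq b \<and>
          (\<forall>c. expansion q (v a) c \<and> infinite_seq c \<longrightarrow> lex_le c b)) = a"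
  proof (rule the_equality)
    show "expansion q (v a) a \<and> infinite_seq a \<and>
          (\<forall>c. expansion q (v a) c \<and> infinite_seq c \<longrightarrow> lex_le c a)"
      using a quasigreedy_seq_largest[OF assms] by (auto simp: expansion_iff)
  next
    fix b assume "expansion q (v a) b \<and> infinite_seq b \<and>
          (\<forall>c. expansion q (v a) c \<and> infinite_seq c \<longrightarrow> lex_le c b)"
    then show "b = a"
      using a quasigreedy_seq_largest[OF assms] by (auto simp: expansion_iff intro: lex_le_antisym)
  qed
  with pos show ?thesis by (simp add: quasi_greedy_def)
qed

lemma greedy_step:
  assumes "0 < y" "y \<le> M / (q - 1)"
  defines "d \<equiv> min M (nat (\<lceil>q * y\<rceil> - 1))"
  shows "0 < q * y - d" "q * y - d \<le> M / (q - 1)" "d < M \<Longrightarrow> q * y - d \<le> 1"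
proof -
  have "0 < q * y" using assms q_gt_1 by simp
  then have "\<lceil>q * y\<rceil> \<ge> 1" by linarith
  then have e: "real (nat (\<lceil>q * y\<rceil> - 1)) = real_of_int \<lceil>q * y\<rceil> - 1" by simp
  have *: "q * (M / (q - 1)) - M = M / (q - 1)" using q_gt_1 by (simp add: field_simps)
  have le: "q * y \<le> q * (M / (q - 1))"
    using assms(2) q_gt_1 by (intro mult_left_mono) auto
  have "0 < q * y - d \<and> q * y - d \<le> M / (q - 1) \<and> (d < M \<longrightarrow> q * y - d \<le> 1)"
  proof (cases "nat (\<lceil>q * y\<rceil> - 1) \<le> M")
    case True
    then have d: "real d = real_of_int \<lceil>q * y\<rceil> - 1" using e by (simp add: d_def min_def)
    then have "0 < q * y - d" "q * y - d \<le> 1" by linarith+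
    then show ?thesis using one_le_J by linarith
  next
    case False
    then have d: "d = M" by (simp add: d_def)
    from False have "real M < real (nat (\<lceil>q * y\<rceil> - 1))" by simp
    then have "real M < q * y" using e by linarith
    then show ?thesis using * le d by linarith
  qed
  then show "0 < q * y - d" "q * y - d \<le> M / (q - 1)" "d < M \<Longrightarrow> q * y - d \<le> 1" by auto
qed

text \<open>
  The quasi-greedy algorithm: at each step take the largest digit that leaves a positive remainder.
\<close>

lemma quasigreedy_seq_exists:
  assumes "0 < x" "x \<in> J q"
  obtains a where "quasigreedy_seq a" "v a = x"
proof -
  define d where "d = (\<lambda>y. min M (nat (\<lceil>q * y\<rceil> - 1)))"
  define r where "r = (\<lambda>n. ((\<lambda>y. q * y - d y) ^^ n) x)"
  define a where "a = (\<lambda>n. d (r n))"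
  have r_Suc: "r (Suc n) = q * r n - a n" for n by (simp add: r_def a_def)
  have r_bounds: "0 < r n \<and> r n \<le> M / (q - 1)" for n
  proof (induction n)
    case 0
    then show ?case using assms by (simp add: r_def J_eq)
  next
    case (Suc n)
    then show ?case using greedy_step(1,2)[of "r n"] by (simp add: r_Suc a_def d_def)
  qed
  have dig: "digits M a" by (simp add: digits_def a_def d_def)
  have partial: "(\<Sum>i<n. a i / q ^ Suc i) = x - r n / q ^ n" for n
  proof (induction n)
    case 0
    then show ?case by (simp add: r_def)
  next
    case (Suc n)
    moreover have "r n / q ^ n = (q * r n) / q ^ Suc n" using q_gt_1 by simp
    then have "r n / q ^ n = a n / q ^ Suc n + r (Suc n) / q ^ Suc n"
      by (simp add: r_Suc flip: add_divide_distrib)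
    ultimately show ?case by simp
  qed
  have "(\<lambda>n. r n / q ^ n) \<longlonglongrightarrow> 0"
  proof (rule tendsto_sandwich[where f = "\<lambda>_. 0"])
    have "(\<lambda>n. (M / (q - 1)) * (1 / q) ^ n) \<longlonglongrightarrow> (M / (q - 1)) * 0"
      using q_gt_1 by (intro tendsto_mult_left LIMSEQ_realpow_zero) auto
    then show "(\<lambda>n. (M / (q - 1)) * (1 / q) ^ n) \<longlonglongrightarrow> 0" by simp
    show "\<forall>\<^sub>F n in sequentially. r n / q ^ n \<le> (M / (q - 1)) * (1 / q) ^ n"
    proof (rule always_eventually, rule allI)
      fix n
      have "r n / q ^ n \<le> (M / (q - 1)) / q ^ n"
        using r_bounds[of n] q_gt_1 by (intro divide_right_mono) auto
      then show "r n / q ^ n \<le> (M / (q - 1)) * (1 / q) ^ n"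
        by (simp add: power_one_over)
    qed
    show "\<forall>\<^sub>F n in sequentially. 0 \<le> r n / q ^ n"
      using r_bounds q_gt_1 by (intro always_eventually allI) (simp add: less_imp_le)
  qed auto
  then have "(\<lambda>n. x - r n / q ^ n) \<longlonglongrightarrow> x - 0" by (intro tendsto_intros)
  then have "(\<lambda>i. a i / q ^ Suc i) sums x"
    unfolding sums_def partial by simp
  then have va: "v a = x" using val_sums[OF dig] sums_unique2 by blast
  have tail_val: "v (tail n a) = r n" for n
    using val_prefix[OF dig, of n] partial[of n] va q_gt_1 by simp
  have "infinite_seq a"
  proof (rule ccontr)
    assume fin: "\<not> infinite_seq a"
    have "a \<noteq> (\<lambda>_. 0)" using va assms(1) val_zero by auto
    then obtain n where "tail (Suc n) a = (\<lambda>_. 0)" using fin not_infinite_seqD by blast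
    then show False using tail_val[of "Suc n"] r_bounds[of "Suc n"] by simp
  qed
  moreover have "v (tail (Suc n) a) \<le> 1" if "a n < M" for n
    using greedy_step(3)[of "r n"] r_bounds[of n] that unfolding tail_val r_Suc
    by (simp add: a_def d_def)
  ultimately have "quasigreedy_seq a" using dig by (simp add: quasigreedy_seq_def)
  then show ?thesis using va that by blast
qed

lemma expansion_exists:
  assumes "x \<in> J q"
  obtains c where "digits M c" "v c = x"
proof (cases "x = 0")
  case True
  then show ?thesis using that[of "\<lambda>_. 0"] by (simp add: digits_def)
next
  case False
  then have "0 < x" using assms by (simp add: J_eq)
  then show ?thesis using quasigreedy_seq_exists[OF _ assms] that quasigreedy_seqD(1) by metis
qed

abbreviation a1 :: "nat \<Rightarrow> nat" where "a1 \<equiv> quasi_greedy q 1"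

lemma quasigreedy_a1: "quasigreedy_seq a1" "v a1 = 1"
proof -
  have "1 \<in> J q" using one_le_J by (simp add: J_eq)
  then obtain a where "quasigreedy_seq a" "v a = 1"
    using quasigreedy_seq_exists[of 1] by auto
  then show "quasigreedy_seq a1" "v a1 = 1" using quasi_greedy_val by metis+
qed

lemmas a1_digits [simp, intro] = quasigreedy_seqD(1)[OF quasigreedy_a1(1)]
lemmas a1_infinite [simp, intro] = quasigreedy_seqD(2)[OF quasigreedy_a1(1)]

text \<open>
  The values of the shifts and the lexicographic order are compared through the following lemmas:
  a value below \<open>1\<close> forces a sequence below \<open>a1\<close>, without further assumptions, whereas the converse
  \<open>less_imp_val_less_1\<close> requires the lexicographic conditions on the shifts.
\<close>

lemma val_less_1_imp_less:
  assumes "digits M t" "v t < 1"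
  shows "less_fun t a1"
proof (rule ccontr)
  assume "\<not> less_fun t a1"
  moreover have "t \<noteq> a1" using assms(2) quasigreedy_a1(2) by auto
  ultimately have "less_fun a1 t" using less_fun_linear by blast
  then obtain k where k: "a1 k < t k" "\<And>j. j < k \<Longrightarrow> a1 j = t j"
    unfolding less_fun_def by blast
  have "v (tail (Suc k) a1) \<le> 1"
    using k(1) digitsD[OF assms(1), of k] quasigreedy_seqD(3)[OF quasigreedy_a1(1)] by simp
  moreover have "v (tail (Suc k) t) \<ge> 0" using assms(1) val_nonneg by blast
  ultimately have "real (a1 k) - real (t k) + v (tail (Suc k) a1) - v (tail (Suc k) t) \<le> 0"
    using k(1) by linarith
  then have "v a1 - v t \<le> 0"
    using q_gt_1
    by (subst val_split[OF a1_digits assms(1) k(2)]) (auto simp: divide_le_0_iff)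
  then show False using assms(2) quasigreedy_a1(2) by simp
qed

lemma val_le_1_imp_lex_le:
  assumes "digits M t" "infinite_seq t" "v t \<le> 1"
  shows "lex_le t a1"
proof (cases "v t = 1")
  case True
  then show ?thesis using assms quasigreedy_seq_largest[OF quasigreedy_a1(1)] quasigreedy_a1(2) by simp
next
  case False
  then show ?thesis using assms val_less_1_imp_less by (simp add: lex_le_def)
qed

text \<open>
  If \<open>v s\<close> were at least \<open>1\<close>, then comparing \<open>s\<close> with \<open>b\<close> at their first difference would give
  a shift of \<open>s\<close> of the same kind whose excess over \<open>1\<close> is positive and at least \<open>q\<close> times that of \<open>s\<close>;
  repeating this contradicts the boundedness of \<open>v\<close>.
\<close>

lemma less_imp_val_less_1:
  assumes b: "digits M b" "infinite_seq b" "v b = 1"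
    and "digits M s" "\<And>n. s n < M \<Longrightarrow> lex_le (tail (Suc n) s) b" "less_fun s b"
  shows "v s < 1"
proof (rule ccontr)
  define P where "P = (\<lambda>y s. digits M s \<and> (\<forall>n. s n < M \<longrightarrow> lex_le (tail (Suc n) s) b) \<and>
                        less_fun s b \<and> y \<le> v s - 1)"
  \<comment> \<open>the excess over \<open>1\<close> grows by the factor \<open>q\<close>, and is strictly positive even when \<open>y = 0\<close>\<close>
  have step: "\<exists>t z. P z t \<and> z > 0 \<and> z \<ge> q * y" if "P y s" "y \<ge> 0" for y s
  proof -
    from that obtain k where k: "s k < b k" "\<And>j. j < k \<Longrightarrow> s j = b j"
      unfolding P_def less_fun_def by blast
    let ?t = "tail (Suc k) s"
    have ds: "digits M s" using that P_def by blast
    have "v s - v b = (real (s k) - real (b k) + v ?t - v (tail (Suc k) b)) / q ^ Suc k"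
      by (rule val_split[OF ds b(1) k(2)])
    moreover have "v (tail (Suc k) b) > 0" using b by (intro val_pos_infinite) auto
    ultimately have "(v s - 1) * q ^ Suc k < v ?t - 1"
      using k(1) b(3) q_gt_1 by (simp add: field_simps)
    moreover have "q * y \<le> (v s - 1) * q ^ Suc k"
    proof -
      have "y \<le> v s - 1" using that P_def by blast
      moreover have "q ^ 1 \<le> q ^ Suc k" using q_gt_1 by (intro power_increasing) auto
      ultimately have "y * q \<le> (v s - 1) * q ^ Suc k"
        using that(2) q_gt_1 by (intro mult_mono) auto
      then show ?thesis by (simp add: mult.commute)
    qed
    moreover have "0 \<le> q * y" using that(2) q_gt_1 by simp
    ultimately have gt: "v ?t - 1 > 0" "v ?t - 1 \<ge> q * y" by linarith+
    have "s k < M" using k(1) digitsD[OF b(1), of k] by simp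
    then have "lex_le ?t b" using that P_def by blast
    then have "less_fun ?t b" using gt(1) b(3) by (auto simp: lex_le_def)
    then have "P (v ?t - 1) ?t"
      using that ds unfolding P_def by (metis add_Suc_right digits_tail order_refl tail_apply tail_tail)
    with gt show ?thesis by blast
  qed
  assume "\<not> v s < 1"
  then have "P 0 s" using assms by (simp add: P_def)
  then obtain t z where tz: "P z t" "z > 0" using step by blast
  have "\<exists>s y. P y s \<and> y \<ge> q ^ n * z" for n
  proof (induction n)
    case 0
    then show ?case using tz by (intro exI[of _ t] exI[of _ z]) simp
  next
    case (Suc n)
    then obtain s y where sy: "P y s" "y \<ge> q ^ n * z" by blast
    moreover have "q ^ n * z \<ge> 0" using tz q_gt_1 by simp
    ultimately obtain t w where "P w t" "w \<ge> q * y" using step[of y s] by fastforce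
    moreover have "q * y \<ge> q ^ Suc n * z"
      using mult_left_mono[OF sy(2), of q] q_gt_1 by (simp add: mult.assoc)
    ultimately show ?case by (intro exI[of _ t] exI[of _ w]) simp
  qed
  moreover have "y \<le> M / (q - 1)" if "P y s" for y s
    using that val_le[of M s] unfolding P_def by auto
  ultimately have "q ^ n * z \<le> M / (q - 1)" for n by (meson order_trans)
  moreover obtain n where "M / (q - 1) / z < q ^ n" using real_arch_pow[OF q_gt_1] by blast
  then have "M / (q - 1) < q ^ n * z" by (simp only: pos_divide_less_eq[OF tz(2)])
  ultimately show False by (meson not_less)
qed

lemma lex_le_imp_val_le_1:
  assumes b: "digits M b" "infinite_seq b" "v b = 1"
    and "digits M s" "\<And>n. s n < M \<Longrightarrow> lex_le (tail (Suc n) s) b" "lex_le s b"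
  shows "v s \<le> 1"
  using less_imp_val_less_1[OF assms(1-5)] assms(3,6) by (auto simp: lex_le_def)

text \<open>
  The lexicographic characterisation of quasi-greedy sequences. It applies to an arbitrary infinite
  expansion \<open>b\<close> of \<open>1\<close>, which makes it usable for recognising the quasi-greedy expansion of \<open>1\<close>.
\<close>

lemma quasigreedy_seqI:
  assumes b: "digits M b" "infinite_seq b" "v b = 1"
    and s: "digits M s" "infinite_seq s" "\<And>n. s n < M \<Longrightarrow> lex_le (tail (Suc n) s) b"
  shows "quasigreedy_seq s"
proof -
  have "v (tail (Suc n) s) \<le> 1" if "s n < M" for n
    using s that by (intro lex_le_imp_val_le_1[OF b]) auto
  then show ?thesis using s by (simp add: quasigreedy_seq_def)
qed

lemma quasigreedy_seq_lex:
  assumes "quasigreedy_seq s" "s n < M"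
  shows "lex_le (tail (Suc n) s) a1"
  using quasigreedy_seqD[OF assms(1)] assms(2) by (intro val_le_1_imp_lex_le) auto

lemma a1_0: "a1 0 = M"
proof (rule ccontr)
  assume "a1 0 \<noteq> M"
  then have "a1 0 < M" using digitsD[OF a1_digits, of 0] by simp
  then have "v (tail (Suc 0) a1) \<le> 1" using quasigreedy_seqD(3)[OF quasigreedy_a1(1)] by blast
  then have "q - real (a1 0) \<le> 1" using val_tail_Suc[OF a1_digits, of 0] quasigreedy_a1(2) by simp
  then have "a1 0 \<ge> M" using M_bounds \<open>a1 0 < M\<close> by linarith
  then show False using \<open>a1 0 < M\<close> by simp
qed

text \<open>
  For quasi-greedy sequences in general, the bound \<open>1\<close> holds only after digits below \<open>M\<close>. For \<open>a1\<close> it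
  holds everywhere: a digit \<open>M\<close> changes the remainder \<open>y\<close> into \<open>q * y - M\<close>, which is at most \<open>y\<close>.
\<close>

lemma val_tail_a1: "v (tail n a1) \<le> 1"
proof (induction n)
  case 0
  then show ?case using quasigreedy_a1(2) by simp
next
  case (Suc n)
  show ?case
  proof (cases "a1 n < M")
    case False
    then have "a1 n = M" using digitsD[OF a1_digits, of n] by simp
    then have "v (tail (Suc n) a1) = v (tail n a1) + ((q - 1) * v (tail n a1) - M)"
      using val_tail_Suc[OF a1_digits, of n] by (simp add: algebra_simps)
    moreover have "(q - 1) * v (tail n a1) \<le> M"
      using val_le[of M "tail n a1"] q_gt_1 by (simp add: pos_le_divide_eq mult.commute)
    ultimately show ?thesis using Suc by linarith
  qed (use quasigreedy_seqD(3)[OF quasigreedy_a1(1)] in blast)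
qed

lemma tail_a1_le: "lex_le (tail n a1) a1"
  using val_tail_a1 by (intro val_le_1_imp_lex_le) auto

end

section \<open>Admissible sequences and the expansions of their values\<close>

context base
begin

text \<open>
  The closed lexicographic conditions: the upper one bounds the shifts of \<open>c\<close>, the lower one the
  shifts of its reflection. The values of these sequences form \<open>V_set q\<close> (lemma \<open>V_set_eq\<close>).
\<close>

definition admissible :: "(nat \<Rightarrow> nat) \<Rightarrow> bool" where
  "admissible c \<longleftrightarrow> digits M c \<and>
     (\<forall>n. c n < M \<longrightarrow> lex_le (tail (Suc n) c) a1) \<and>
     (\<forall>n. 0 < c n \<longrightarrow> lex_le (flip M (tail (Suc n) c)) a1)"

text \<open>
  The strict version of these conditions, which characterises the sequences of uniquely
  represented numbers (lemma \<open>univoque_iff_strictly_admissible\<close>).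
\<close>

definition strictly_admissible :: "(nat \<Rightarrow> nat) \<Rightarrow> bool" where
  "strictly_admissible c \<longleftrightarrow> digits M c \<and>
     (\<forall>n. c n < M \<longrightarrow> less_fun (tail (Suc n) c) a1) \<and>
     (\<forall>n. 0 < c n \<longrightarrow> less_fun (flip M (tail (Suc n) c)) a1)"

text \<open>
  The positions at which the upper, respectively the lower, condition holds with equality.
\<close>

definition meets_upper :: "(nat \<Rightarrow> nat) \<Rightarrow> nat \<Rightarrow> bool" where
  "meets_upper c n \<longleftrightarrow> c n < M \<and> tail (Suc n) c = a1"

definition meets_lower :: "(nat \<Rightarrow> nat) \<Rightarrow> nat \<Rightarrow> bool" where
  "meets_lower c n \<longleftrightarrow> 0 < c n \<and> flip M (tail (Suc n) c) = a1"

text \<open>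
  The two ways of rewriting a sequence with the same value: after a digit below \<open>M\<close> the
  tail \<open>a1\<close> has value \<open>1\<close> and may be replaced by \<open>0\<^sup>\<infinity>\<close> while the digit is increased; dually, after a
  positive digit the tail \<open>flip M a1\<close> may be replaced by \<open>M\<^sup>\<infinity>\<close> while the digit is decreased.
\<close>

definition raise :: "(nat \<Rightarrow> nat) \<Rightarrow> nat \<Rightarrow> nat \<Rightarrow> nat" where
  "raise c n = (\<lambda>i. if i < n then c i else if i = n then Suc (c n) else 0)"

definition lower :: "(nat \<Rightarrow> nat) \<Rightarrow> nat \<Rightarrow> nat \<Rightarrow> nat" where
  "lower c n = (\<lambda>i. if i < n then c i else if i = n then c n - 1 else M)"

lemma admissibleD:
  assumes "admissible c"
  shows "digits M c" "\<And>n. c n < M \<Longrightarrow> lex_le (tail (Suc n) c) a1"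
    "\<And>n. 0 < c n \<Longrightarrow> lex_le (flip M (tail (Suc n) c)) a1"
  using assms by (auto simp: admissible_def)

lemma strictly_admissibleD:
  assumes "strictly_admissible c"
  shows "digits M c" "\<And>n. c n < M \<Longrightarrow> less_fun (tail (Suc n) c) a1"
    "\<And>n. 0 < c n \<Longrightarrow> less_fun (flip M (tail (Suc n) c)) a1"
  using assms by (auto simp: strictly_admissible_def)

lemma flip_less_M_iff: "digits M c \<Longrightarrow> M - c n < M \<longleftrightarrow> 0 < c n"
  using M_bounds(3) by auto

lemma admissible_flip: "admissible c \<Longrightarrow> admissible (flip M c)"
  by (auto simp: admissible_def flip_less_M_iff)

lemma meets_upper_flip: "digits M c \<Longrightarrow> meets_upper (flip M c) n \<longleftrightarrow> meets_lower c n"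
  by (simp add: meets_upper_def meets_lower_def flip_less_M_iff)

lemma meets_lower_flip: "digits M c \<Longrightarrow> meets_lower (flip M c) n \<longleftrightarrow> meets_upper c n"
  by (simp add: meets_upper_def meets_lower_def)

lemma strictly_admissible_iff:
  "strictly_admissible c \<longleftrightarrow> admissible c \<and> (\<forall>n. \<not> meets_upper c n \<and> \<not> meets_lower c n)"
proof -
  have "less_fun s a1 \<longleftrightarrow> lex_le s a1 \<and> s \<noteq> a1" for s
    using less_fun_irrefl lex_le_def by blast
  then show ?thesis
    unfolding strictly_admissible_def admissible_def meets_upper_def meets_lower_def by blast
qed

lemma lex_le_const_M: "digits M t \<Longrightarrow> lex_le t (\<lambda>_. M)"
  unfolding lex_le_iff_not_less less_fun_def using digitsD not_less by metis

lemma lex_le_zero: "lex_le (\<lambda>_. 0) t"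
  by (simp add: lex_le_iff_not_less less_fun_def)

lemma reflection_eq: "reflection q c = flip M c"
  by (simp add: reflection_def flip_def a1_0)

lemma admissible_infinite_quasigreedy:
  assumes "admissible c" "infinite_seq c"
  shows "quasigreedy_seq c"
  using admissibleD[OF assms(1)] assms(2) quasigreedy_a1 by (intro quasigreedy_seqI[of a1]) auto

lemma V_set_nonzero:
  assumes x: "x \<in> V_set q" "x \<noteq> 0"
  obtains a where "admissible a" "infinite_seq a" "v a = x"
proof -
  have xJ: "x \<in> J q" using x by (simp add: V_set_def)
  then have "0 < x" using x(2) by (simp add: J_eq)
  then obtain a where a: "quasigreedy_seq a" "v a = x" using quasigreedy_seq_exists xJ by blast
  have qg: "quasi_greedy q x = a" using quasi_greedy_val[OF a(1)] a(2) by simp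
  have "lex_le (flip M (tail (Suc n) a)) a1" if "a n > 0" for n
    using x that by (simp add: V_set_def qg reflection_eq tail_def)
  then have "admissible a"
    using quasigreedy_seqD[OF a(1)] quasigreedy_seq_lex[OF a(1)] by (simp add: admissible_def)
  then show ?thesis using that a(2) quasigreedy_seqD(2)[OF a(1)] by blast
qed

lemma admissible_zero: "admissible (\<lambda>_. 0)"
  by (auto simp: admissible_def digits_def lex_le_zero tail_def)

text \<open>
  A finite nonzero admissible sequence forces \<open>a1 = M\<^sup>\<infinity>\<close>; then the lexicographic conditions are
  void, and \<open>V_set q\<close> is all of \<open>J q\<close>.
\<close>

lemma V_set_eq: "V_set q = v ` {c. admissible c}"
proof (intro equalityI subsetI)
  fix x assume x: "x \<in> V_set q"
  show "x \<in> v ` {c. admissible c}"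
  proof (cases "x = 0")
    case True
    then show ?thesis using admissible_zero by force
  next
    case False
    then show ?thesis using V_set_nonzero[OF x] by blast
  qed
next
  fix x assume "x \<in> v ` {c. admissible c}"
  then obtain c where c: "admissible c" "v c = x" by blast
  note cd = admissibleD[OF c(1)]
  have xJ: "x \<in> J q" using c val_in_J cd(1) by blast
  have "lex_le (reflection q (\<lambda>i. quasi_greedy q x (Suc n + i))) a1"
    if pos: "quasi_greedy q x n > 0" for n
  proof -
    consider "infinite_seq c" | "c = (\<lambda>_. 0)" | "\<not> infinite_seq c" "c \<noteq> (\<lambda>_. 0)" by blast
    then show ?thesis
    proof cases
      case 1
      then have "quasi_greedy q x = c"
        using quasi_greedy_val admissible_infinite_quasigreedy c by blast
      then show ?thesis using cd(3)[of n] pos unfolding reflection_eq tail_def by simp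
    next
      case 2
      then have "quasi_greedy q x n = 0" using c by (simp add: quasi_greedy_def)
      then show ?thesis using pos by simp
    next
      case 3
      then obtain k where "c k > 0" "tail (Suc k) c = (\<lambda>_. 0)" using not_infinite_seqD by blast
      then have "lex_le (\<lambda>_. M) a1" using cd(3)[of k] by (simp add: flip_def)
      then have "a1 = (\<lambda>_. M)" using lex_le_const_M[of a1] lex_le_antisym by blast
      then show ?thesis unfolding reflection_eq using lex_le_const_M by simp
    qed
  qed
  then show "x \<in> V_set q" using xJ by (simp add: V_set_def)
qed

lemma raise_expansion:
  assumes "digits M c" "meets_upper c n"
  shows "digits M (raise c n)" "v (raise c n) = v c"
proof -
  show d: "digits M (raise c n)"
    using assms by (auto simp: digits_def raise_def meets_upper_def)
  have "tail (Suc n) (raise c n) = (\<lambda>_. 0)" by (auto simp: raise_def)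
  moreover have "v (tail (Suc n) c) = 1" using assms quasigreedy_a1(2) by (simp add: meets_upper_def)
  ultimately have "v (raise c n) - v c = 0"
    by (subst val_split[OF d assms(1), of n]) (auto simp: raise_def)
  then show "v (raise c n) = v c" by simp
qed

lemma lower_eq_flip_raise:
  "digits M c \<Longrightarrow> 0 < c n \<Longrightarrow> lower c n = flip M (raise (flip M c) n)"
  by (auto simp: lower_def raise_def digits_def)

lemma lower_expansion:
  assumes "digits M c" "meets_lower c n"
  shows "digits M (lower c n)" "v (lower c n) = v c"
proof -
  have eq: "lower c n = flip M (raise (flip M c) n)"
    using assms by (intro lower_eq_flip_raise) (auto simp: meets_lower_def)
  show "digits M (lower c n)" unfolding eq by simp
  have up: "meets_upper (flip M c) n" using assms by (simp add: meets_upper_flip)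
  show "v (lower c n) = v c"
    unfolding eq using raise_expansion[OF digits_flip up] val_flip assms(1) by simp
qed

lemma larger_expansion:
  assumes "digits M c" "\<And>n. c n < M \<Longrightarrow> lex_le (tail (Suc n) c) a1"
    and "digits M d" "v d = v c" "less_fun c d"
  shows "\<exists>n. meets_upper c n \<and> d = raise c n"
proof -
  from assms(5) obtain k where k: "c k < d k" "\<And>j. j < k \<Longrightarrow> c j = d j"
    unfolding less_fun_def by blast
  have ck: "c k < M" using k(1) digitsD[OF assms(3), of k] by simp
  have "v c - v d = (real (c k) - real (d k) + v (tail (Suc k) c) - v (tail (Suc k) d)) / q ^ Suc k"
    by (rule val_split[OF assms(1,3) k(2)])
  then have eq: "real (c k) - real (d k) + v (tail (Suc k) c) - v (tail (Suc k) d) = 0"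
    using assms(4) q_gt_1 by auto
  have le1: "v (tail (Suc k) c) \<le> 1"
    by (rule lex_le_imp_val_le_1[of a1]) (use assms(1,2) ck quasigreedy_a1(2) in auto)
  have ge0: "v (tail (Suc k) d) \<ge> 0" using assms(3) val_nonneg by blast
  have "real (d k) \<ge> real (c k) + 1" using k(1) by linarith
  then have "real (d k) = real (c k) + 1" and v1: "v (tail (Suc k) c) = 1"
    and v0: "v (tail (Suc k) d) = 0"
    using eq le1 ge0 by linarith+
  then have dk: "d k = Suc (c k)" by linarith
  have "tail (Suc k) c = a1"
  proof (rule ccontr)
    assume "tail (Suc k) c \<noteq> a1"
    then have "less_fun (tail (Suc k) c) a1" using assms(2)[OF ck] by (simp add: lex_le_def)
    then have "v (tail (Suc k) c) < 1"
      by (intro less_imp_val_less_1[of a1]) (use assms(1,2) quasigreedy_a1(2) in auto)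
    then show False using v1 by simp
  qed
  moreover have "d = raise c k"
  proof
    fix i
    have "tail (Suc k) d = (\<lambda>_. 0)" using v0 assms(3) val_eq_0 by blast
    then have "d (Suc k + (i - Suc k)) = 0" by (metis tail_apply)
    then show "d i = raise c k i" using k(2)[of i] dk by (auto simp: raise_def)
  qed
  ultimately show ?thesis using ck by (auto simp: meets_upper_def)
qed

text \<open>
  All expansions of the value of an admissible sequence. The number of expansions is later found by
  counting the positions of equality.
\<close>

lemma expansions_of_admissible:
  assumes "admissible c"
  shows "{d. expansion q (v c) d} =
    insert c (raise c ` {n. meets_upper c n} \<union> lower c ` {n. meets_lower c n})"
proof (intro equalityI subsetI)
  note c = admissibleD[OF assms]
  fix d assume "d \<in> {d. expansion q (v c) d}"
  then have d: "digits M d" "v d = v c" by (auto simp: expansion_iff)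
  consider "d = c" | "less_fun c d" | "less_fun d c" using less_fun_linear by blast
  then show "d \<in> insert c (raise c ` {n. meets_upper c n} \<union> lower c ` {n. meets_lower c n})"
  proof cases
    case 2
    then show ?thesis using larger_expansion[OF c(1,2) d] by blast
  next
    case 3
    then have "less_fun (flip M c) (flip M d)" using flip_less c(1) d(1) by blast
    moreover have "v (flip M d) = v (flip M c)" using val_flip c(1) d by simp
    ultimately obtain n where n: "meets_upper (flip M c) n" "flip M d = raise (flip M c) n"
      using larger_expansion[OF admissibleD(1,2)[OF admissible_flip[OF assms]]] by blast
    then have low: "meets_lower c n" using c(1) meets_upper_flip by blast
    then have "lower c n = flip M (flip M d)"
      using lower_eq_flip_raise[OF c(1)] n(2) by (simp add: meets_lower_def)
    then have "lower c n = d" using d(1) by simp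
    then show ?thesis using low by blast
  qed auto
next
  note c = admissibleD[OF assms]
  fix d assume "d \<in> insert c (raise c ` {n. meets_upper c n} \<union> lower c ` {n. meets_lower c n})"
  then show "d \<in> {d. expansion q (v c) d}"
    using raise_expansion[OF c(1)] lower_expansion[OF c(1)] c(1) by (auto simp: expansion_iff)
qed

lemma univoque_val_iff:
  assumes "digits M c"
  shows "v c \<in> univoque_set q \<longleftrightarrow> (\<forall>d. digits M d \<and> v d = v c \<longrightarrow> d = c)"
  using assms by (auto simp: univoque_set_def expansion_iff)

lemma univoque_flip:
  assumes "digits M c" "v c \<in> univoque_set q"
  shows "v (flip M c) \<in> univoque_set q"
proof -
  have "d = flip M c" if d: "digits M d" "v d = v (flip M c)" for d
  proof -
    have "v (flip M d) = v c" using d assms(1) val_flip by simp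
    then have "flip M d = c" using assms univoque_val_iff digits_flip by blast
    then show ?thesis using d(1) by auto
  qed
  then show ?thesis by (simp add: univoque_val_iff)
qed

text \<open>
  If the tail after a digit below \<open>M\<close> were worth at least \<open>1\<close>, that digit could be increased and the
  rest expanded anew, which would give a second expansion.
\<close>

lemma univoque_tail_less:
  assumes "digits M c" "v c \<in> univoque_set q" "c n < M"
  shows "less_fun (tail (Suc n) c) a1"
proof (rule val_less_1_imp_less)
  show "digits M (tail (Suc n) c)" using assms by blast
  show "v (tail (Suc n) c) < 1"
  proof (rule ccontr)
    assume ge: "\<not> v (tail (Suc n) c) < 1"
    have "v (tail (Suc n) c) \<in> J q" using assms(1) val_in_J by blast
    then have "v (tail (Suc n) c) - 1 \<in> J q" using ge by (auto simp: J_eq)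
    then obtain e where e: "digits M e" "v e = v (tail (Suc n) c) - 1"
      using expansion_exists by blast
    define d where "d = (\<lambda>i. if i < n then c i else if i = n then Suc (c n) else e (i - Suc n))"
    have dd: "digits M d" using assms e by (auto simp: digits_def d_def)
    have "tail (Suc n) d = e" by (auto simp: d_def)
    then have "v d - v c = 0"
      using e by (subst val_split[OF dd assms(1), of n]) (auto simp: d_def)
    then have "d = c" using dd assms univoque_val_iff by simp
    then have "d n = c n" by simp
    then show False by (simp add: d_def)
  qed
qed

lemma univoque_iff_strictly_admissible:
  assumes "digits M c"
  shows "v c \<in> univoque_set q \<longleftrightarrow> strictly_admissible c"
proof
  assume u: "v c \<in> univoque_set q"
  have "less_fun (flip M (tail (Suc n) c)) a1" if "0 < c n" for n
    using univoque_tail_less[OF digits_flip univoque_flip[OF assms u], of n] that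
    by (simp add: flip_less_M_iff[OF assms])
  then show "strictly_admissible c"
    using univoque_tail_less[OF assms u] assms by (simp add: strictly_admissible_def)
next
  assume "strictly_admissible c"
  then have "admissible c" "{n. meets_upper c n} = {}" "{n. meets_lower c n} = {}"
    by (auto simp: strictly_admissible_iff)
  then have "{d. expansion q (v c) d} = {c}" using expansions_of_admissible by simp
  then have "expansion q (v c) d \<longleftrightarrow> d = c" for d by blast
  then show "v c \<in> univoque_set q" by (simp add: univoque_set_def Ex1_def)
qed

lemma univoque_bases_iff: "q \<in> univoque_bases \<longleftrightarrow> strictly_admissible a1"
  using univoque_iff_strictly_admissible[OF a1_digits] q_gt_1 quasigreedy_a1(2)
  by (simp add: univoque_bases_def univoque_set_def)

lemma univoque_subset_V: "univoque_set q \<subseteq> V_set q"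
proof
  fix x assume x: "x \<in> univoque_set q"
  then obtain c where "digits M c" "v c = x" by (auto simp: univoque_set_def expansion_iff)
  then show "x \<in> V_set q"
    using x univoque_iff_strictly_admissible strictly_admissible_iff V_set_eq by blast
qed

lemma V_minus_univoque:
  "V_set q - univoque_set q = v ` {c. admissible c \<and> (\<exists>n. meets_upper c n \<or> meets_lower c n)}"
  unfolding V_set_eq using univoque_iff_strictly_admissible strictly_admissible_iff
    admissibleD(1) by (auto simp: image_iff)

end

section \<open>Limits of digit sequences\<close>

text \<open>
  Pointwise convergence of digit sequences, stated as eventual agreement on each initial segment.
\<close>

definition converges_to :: "(nat \<Rightarrow> nat \<Rightarrow> nat) \<Rightarrow> (nat \<Rightarrow> nat) \<Rightarrow> bool" where
  "converges_to f c \<longleftrightarrow> (\<forall>n. \<forall>\<^sub>F k in sequentially. \<forall>i<n. f k i = c i)"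

text \<open>
  Compactness of the space of digit sequences.
\<close>

lemma converges_to_subsequence:
  assumes "\<And>k. digits N (f k)"
  obtains r c where "strict_mono (r :: nat \<Rightarrow> nat)" "converges_to (f \<circ> r) c" "digits N c"
proof -
  let ?D = "PiE (UNIV :: nat set) (\<lambda>_. {..N})"
  have "compactin (product_topology (\<lambda>_. euclidean) UNIV) ?D"
    by (subst compactin_PiE) (auto intro: finite_imp_compact)
  then have "compact ?D" by (simp add: euclidean_product_topology)
  then have sc: "seq_compact ?D" by (rule compact_imp_seq_compact)
  have "\<forall>k. f k \<in> ?D" using assms by (auto simp: digits_def)
  then obtain c r where cr: "c \<in> ?D" "strict_mono r" "(f \<circ> r) \<longlonglongrightarrow> c"
    by (rule seq_compactE[OF sc])
  have ev: "\<forall>\<^sub>F k in sequentially. (f \<circ> r) k i = c i" for i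
  proof -
    have "continuous_on UNIV (\<lambda>x :: nat \<Rightarrow> nat. x i)" by simp
    then have "(\<lambda>k. (f \<circ> r) k i) \<longlonglongrightarrow> c i"
      by (rule continuous_on_tendsto_compose[OF _ cr(3)]) auto
    then show ?thesis by (simp add: tendsto_discrete)
  qed
  have "converges_to (f \<circ> r) c"
    unfolding converges_to_def
  proof
    fix n
    have "\<forall>\<^sub>F k in sequentially. \<forall>i\<in>{..<n}. (f \<circ> r) k i = c i"
      using ev by (intro eventually_ball_finite) auto
    then show "\<forall>\<^sub>F k in sequentially. \<forall>i<n. (f \<circ> r) k i = c i"
      by (rule eventually_mono) simp
  qed
  moreover have "digits N c" using cr(1) by (auto simp: digits_def)
  ultimately show ?thesis using that cr(2) by blast
qed

lemma converges_toD: "converges_to f c \<Longrightarrow> \<forall>\<^sub>F k in sequentially. f k i = c i"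
  unfolding converges_to_def by (drule spec[of _ "Suc i"], erule eventually_mono) simp

lemma converges_to_tail: "converges_to f c \<Longrightarrow> converges_to (\<lambda>k. tail m (f k)) (tail m c)"
  unfolding converges_to_def
proof
  fix n assume "\<forall>n. \<forall>\<^sub>F k in sequentially. \<forall>i<n. f k i = c i"
  then have "\<forall>\<^sub>F k in sequentially. \<forall>i<m + n. f k i = c i" by blast
  then show "\<forall>\<^sub>F k in sequentially. \<forall>i<n. tail m (f k) i = tail m c i"
    by (rule eventually_mono) simp
qed

lemma converges_to_flip: "converges_to f c \<Longrightarrow> converges_to (\<lambda>k. flip N (f k)) (flip N c)"
  unfolding converges_to_def
proof
  fix n assume "\<forall>n. \<forall>\<^sub>F k in sequentially. \<forall>i<n. f k i = c i"
  then have "\<forall>\<^sub>F k in sequentially. \<forall>i<n. f k i = c i" by blast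
  then show "\<forall>\<^sub>F k in sequentially. \<forall>i<n. flip N (f k) i = flip N c i"
    by (rule eventually_mono) simp
qed

lemma converges_to_const: "converges_to (\<lambda>k. c) c"
  by (simp add: converges_to_def)

lemma converges_to_lex_le:
  assumes "converges_to f c" "converges_to g d" "\<forall>\<^sub>F k in sequentially. lex_le (f k) (g k)"
  shows "lex_le c d"
proof (rule ccontr)
  assume "\<not> lex_le c d"
  then obtain j where j: "d j < c j" "\<And>i. i < j \<Longrightarrow> d i = c i"
    unfolding lex_le_iff_not_less less_fun_def by blast
  have "\<forall>\<^sub>F k in sequentially. (\<forall>i<Suc j. f k i = c i) \<and> (\<forall>i<Suc j. g k i = d i) \<and> lex_le (f k) (g k)"
    using assms unfolding converges_to_def by (intro eventually_conj) blast+
  then obtain k where k: "\<forall>i<Suc j. f k i = c i" "\<forall>i<Suc j. g k i = d i" "lex_le (f k) (g k)"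
    using eventually_happens' sequentially_bot by blast
  then have "less_fun (g k) (f k)" using j unfolding less_fun_def by (metis less_Suc_eq)
  then show False using k(3) by (simp add: lex_le_iff_not_less)
qed

text \<open>
  The value depends continuously on the base and on the sequence together. A varying base
  is needed when \<open>q\<close> is approached by elements of \<open>univoque_bases\<close>.
\<close>

lemma val_tendsto:
  assumes "qs \<longlonglongrightarrow> q" "1 < q" "\<And>k. digits N (f k)" "converges_to f c"
  shows "(\<lambda>k. val (qs k) (f k)) \<longlonglongrightarrow> val q c"
proof -
  define p where "p = (1 + q) / 2"
  have p: "1 < p" "p < q" using assms(2) by (auto simp: p_def)
  interpret p: base p by standard (rule p)
  have lim: "(\<lambda>k. real (f k i) / qs k ^ Suc i) \<longlonglongrightarrow> real (c i) / q ^ Suc i" for i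
  proof (intro tendsto_divide tendsto_power assms(1))
    show "(\<lambda>k. real (f k i)) \<longlonglongrightarrow> real (c i)"
      using converges_toD[OF assms(4), of i] by (intro tendsto_eventually) (auto elim: eventually_mono)
    show "q ^ Suc i \<noteq> 0" using assms(2) by simp
  qed
  have "\<forall>\<^sub>F k in sequentially. p < qs k" using order_tendstoD(1)[OF assms(1) p(2)] .
  then have ev: "\<forall>\<^sub>F k in sequentially. \<forall>i. norm (real (f k i) / qs k ^ Suc i) \<le> real N / p ^ Suc i"
  proof (rule eventually_mono)
    fix k assume k: "p < qs k"
    show "\<forall>i. norm (real (f k i) / qs k ^ Suc i) \<le> real N / p ^ Suc i"
    proof
      fix i
      have "p ^ Suc i \<le> qs k ^ Suc i" using k p by (intro power_mono) auto
      then show "norm (real (f k i) / qs k ^ Suc i) \<le> real N / p ^ Suc i"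
        using digitsD[OF assms(3)] k p by (auto intro!: frac_le simp del: power_Suc)
    qed
  qed
  have "\<forall>\<^sub>F (i, k) in at_top \<times>\<^sub>F sequentially. norm (real (f k i) / qs k ^ Suc i) \<le> real N / p ^ Suc i"
    by (rule eventually_mono[OF eventually_prodI[OF eventually_True ev]]) (auto simp: case_prod_unfold)
  then show ?thesis
    unfolding val_def
    using tannerys_theorem[OF lim _ sums_summable[OF p.geometric_tail[of N]]] by simp
qed

section \<open>Closedness of \<open>V_set q\<close> and limits of univoque bases\<close>

context base
begin

lemma closed_V_set: "closed (V_set q)"
  unfolding closed_sequential_limits
proof (intro allI impI, elim conjE)
  fix x l assume x: "\<forall>k. x k \<in> V_set q" "x \<longlonglongrightarrow> l"
  then have "\<forall>k. \<exists>c. admissible c \<and> v c = x k" unfolding V_set_eq by (metis imageE mem_Collect_eq)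
  then obtain f where f: "\<And>k. admissible (f k)" "\<And>k. v (f k) = x k" by metis
  note fD = admissibleD[OF f(1)]
  obtain r c where r: "strict_mono (r :: nat \<Rightarrow> nat)" and c: "converges_to (f \<circ> r) c" "digits M c"
    using converges_to_subsequence[of M f] fD(1) by blast
  have "(\<lambda>k. v ((f \<circ> r) k)) \<longlonglongrightarrow> v c"
    using fD(1) by (intro val_tendsto[OF _ q_gt_1 _ c(1)]) auto
  moreover have "(\<lambda>k. v ((f \<circ> r) k)) \<longlonglongrightarrow> l"
    using LIMSEQ_subseq_LIMSEQ[OF x(2) r] by (simp add: f(2) o_def)
  ultimately have vc: "v c = l" using LIMSEQ_unique by blast
  have "lex_le (tail (Suc n) c) a1" if "c n < M" for n
  proof (rule converges_to_lex_le[OF converges_to_tail[OF c(1)] converges_to_const])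
    show "\<forall>\<^sub>F k in sequentially. lex_le (tail (Suc n) ((f \<circ> r) k)) a1"
      using converges_toD[OF c(1), of n] by (rule eventually_mono) (use that fD(2) in auto)
  qed
  moreover have "lex_le (flip M (tail (Suc n) c)) a1" if "0 < c n" for n
  proof (rule converges_to_lex_le[OF converges_to_flip[OF converges_to_tail[OF c(1)]] converges_to_const])
    show "\<forall>\<^sub>F k in sequentially. lex_le (flip M (tail (Suc n) ((f \<circ> r) k))) a1"
      using converges_toD[OF c(1), of n] by (rule eventually_mono) (use that fD(3) in auto)
  qed
  ultimately have "admissible c" using c(2) by (simp add: admissible_def)
  then show "l \<in> V_set q" unfolding V_set_eq using vc by blast
qed

lemma a1_integer:
  assumes "q = real_of_int \<lceil>q\<rceil>"
  shows "a1 = (\<lambda>_. M)"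
proof -
  have qM: "q - 1 = M" using assms M_bounds(4) by simp
  then have "v (\<lambda>_. M) = 1" using val_const[of M] q_gt_1 by simp
  moreover have "digits M (\<lambda>_. M)" by (simp add: digits_def)
  moreover have "infinite_seq (\<lambda>_. M)" using M_bounds(3) by (simp add: infinite_seq_def)
  ultimately show ?thesis
    using quasi_greedy_val[of "\<lambda>_. M"] by (simp add: quasigreedy_seq_def)
qed

text \<open>
  If \<open>flip M (tail p a) = a\<close>, then \<open>a\<close> is the periodic sequence whose period consists of a block of
  length \<open>p\<close> and its reflection. A sequence \<open>f\<close> that begins with this period, is at least each of its
  shifts, and is greater than \<open>flip M (tail p f)\<close> can neither exceed nor fall below \<open>a\<close> at a first
  difference, and cannot be equal to \<open>a\<close> either.
\<close>

lemma no_antiperiodic_approximation: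
  assumes "digits M a" "flip M (tail p a) = a" "\<And>i. i < 2 * p \<Longrightarrow> f i = a i"
    and "\<And>n. lex_le (tail n f) f" "less_fun (flip M (tail p f)) f" "0 < p"
  shows False
proof (cases "f = a")
  case True
  then show False using assms(2,5) less_fun_irrefl by auto
next
  case False
  then obtain j where j: "f j \<noteq> a j" "\<And>i. i < j \<Longrightarrow> f i = a i"
    using first_difference by metis
  have "\<not> j < 2 * p" using j(1) assms(3) by blast
  then have jp: "2 * p \<le> j" by simp
  have ap: "M - a (p + i) = a i" for i using fun_cong[OF assms(2), of i] by simp
  have ap': "a (p + i) = M - a i" for i using ap[of i] digitsD[OF assms(1), of "p + i"] by simp
  have a2p: "a (2 * p + i) = a i" for i
    using ap'[of "p + i"] ap[of i] by (simp add: add.assoc mult_2)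
  show False
  proof (cases "a j < f j")
    case True
    \<comment> \<open>above \<open>a\<close>: shifting by a full period contradicts maximality among the shifts\<close>
    have "less_fun f (tail (2 * p) f)"
      unfolding less_fun_def
    proof (intro exI conjI allI impI)
      have e: "2 * p + (j - 2 * p) = j" using jp by simp
      have "f (j - 2 * p) = a (j - 2 * p)" using jp assms(6) by (intro j(2)) auto
      also have "\<dots> = a j" using a2p[of "j - 2 * p"] e by simp
      finally show "f (j - 2 * p) < tail (2 * p) f (j - 2 * p)" using True e by simp
    next
      fix i assume "i < j - 2 * p"
      then show "f i = tail (2 * p) f i" using j(2)[of i] j(2)[of "2 * p + i"] a2p[of i] by simp
    qed
    then show False using assms(4)[of "2 * p"] by (simp add: lex_le_iff_not_less)
  next
    case lt: False
    then have fj: "f j < a j" using j(1) by simp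
    \<comment> \<open>below \<open>a\<close>: shifting by half a period and reflecting contradicts the strict condition\<close>
    have "less_fun f (flip M (tail p f))"
      unfolding less_fun_def
    proof (intro exI conjI allI impI)
      have e: "p + (j - p) = j" using jp by simp
      have "f (j - p) = a (j - p)" using jp assms(6) by (intro j(2)) auto
      also have "\<dots> = M - a j" using ap[of "j - p"] e by simp
      finally show "f (j - p) < flip M (tail p f) (j - p)"
        using fj e digitsD[OF assms(1), of j] by simp
    next
      fix i assume "i < j - p"
      then show "f i = flip M (tail p f) i" using j(2)[of i] j(2)[of "p + i"] ap[of i] by simp
    qed
    then show False using assms(5) less_fun_asym by blast
  qed
qed

text \<open>
  For non-integral \<open>q\<close> the bases near \<open>q\<close> have the same maximal digit. A limit of the expansions of \<open>1\<close>
  in univoque bases tending to \<open>q\<close> then satisfies the lexicographic conditions relative to itself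
  and hence is the quasi-greedy expansion of \<open>1\<close> in base \<open>q\<close>.
\<close>

lemma univoque_approximation:
  assumes "q \<in> closure univoque_bases" "q \<noteq> real_of_int \<lceil>q\<rceil>"
  obtains f where "converges_to f a1"
    "\<And>k n. lex_le (tail n (f k)) (f k)"
    "\<And>k n. 0 < f k n \<Longrightarrow> less_fun (flip M (tail (Suc n) (f k))) (f k)"
proof -
  obtain qs where qs: "\<And>k. qs k \<in> univoque_bases" "qs \<longlonglongrightarrow> q"
    using assms(1) closure_sequential by blast
  have "real_of_int \<lceil>q\<rceil> - 1 < q" "q < real_of_int \<lceil>q\<rceil>" using assms(2) by linarith+
  then have "\<forall>\<^sub>F k in sequentially. real_of_int \<lceil>q\<rceil> - 1 < qs k \<and> qs k < real_of_int \<lceil>q\<rceil>"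
    using qs(2) by (intro eventually_conj order_tendstoD)
  then obtain K where K: "\<And>k. k \<ge> K \<Longrightarrow> real_of_int \<lceil>q\<rceil> - 1 < qs k \<and> qs k < real_of_int \<lceil>q\<rceil>"
    unfolding eventually_sequentially by blast
  define ps where "ps = (\<lambda>k. qs (k + K))"
  have lim: "ps \<longlonglongrightarrow> q" unfolding ps_def using qs(2) by (rule LIMSEQ_ignore_initial_segment)
  have ps: "ps k \<in> univoque_bases" for k using qs(1) by (simp add: ps_def)
  have bk: "base (ps k)" for k using ps[of k] by (simp add: base_def univoque_bases_def)
  have "\<lceil>ps k\<rceil> = \<lceil>q\<rceil>" for k using K[of "k + K"] by (simp add: ps_def ceiling_eq_iff)
  then have M: "maxdig (ps k) = M" for k by (simp add: maxdig_def)
  define f where "f = (\<lambda>k. quasi_greedy (ps k) 1)"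
  have f_dig: "digits M (f k)" and f_val: "val (ps k) (f k) = 1" and f_0: "f k 0 = M"
    and f_tail: "lex_le (tail n (f k)) (f k)" for k n
    using base.a1_digits[OF bk[of k]] base.quasigreedy_a1(2)[OF bk[of k]] base.a1_0[OF bk[of k]]
      base.tail_a1_le[OF bk[of k]] by (simp_all add: f_def M)
  have f_flip: "less_fun (flip M (tail (Suc n) (f k))) (f k)" if "0 < f k n" for k n
    using base.univoque_bases_iff[OF bk[of k]] ps[of k] that
      base.strictly_admissibleD(3)[OF bk[of k]] by (simp add: f_def M)
  obtain r c where r: "strict_mono (r :: nat \<Rightarrow> nat)" and c: "converges_to (f \<circ> r) c" "digits M c"
    using converges_to_subsequence[of M f] f_dig by blast
  have "(\<lambda>k. val ((ps \<circ> r) k) ((f \<circ> r) k)) \<longlonglongrightarrow> v c"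
    using f_dig by (intro val_tendsto[OF LIMSEQ_subseq_LIMSEQ[OF lim r] q_gt_1 _ c(1)]) simp
  then have vc: "v c = 1" by (simp add: f_val LIMSEQ_const_iff)
  obtain k0 where "(f \<circ> r) k0 0 = c 0"
    using eventually_happens'[OF sequentially_bot converges_toD[OF c(1)]] by blast
  then have c0: "c 0 = M" by (simp add: f_0)
  have c_tail: "lex_le (tail n c) c" for n
    by (rule converges_to_lex_le[OF converges_to_tail[OF c(1)] c(1)]) (simp add: f_tail)
  have c_flip: "lex_le (flip M (tail (Suc n) c)) c" if "0 < c n" for n
  proof (rule converges_to_lex_le[OF converges_to_flip[OF converges_to_tail[OF c(1)]] c(1)])
    show "\<forall>\<^sub>F k in sequentially. lex_le (flip M (tail (Suc n) ((f \<circ> r) k))) ((f \<circ> r) k)"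
      using converges_toD[OF c(1), of n]
      by (rule eventually_mono) (use that f_flip in \<open>auto simp: lex_le_def\<close>)
  qed
  have c_inf: "infinite_seq c"
  proof (rule ccontr)
    assume fin: "\<not> infinite_seq c"
    have "c \<noteq> (\<lambda>_. 0)" using c0 M_bounds(3) by auto
    then obtain n where n: "c n > 0" "tail (Suc n) c = (\<lambda>_. 0)"
      using fin not_infinite_seqD by blast
    then have "lex_le (\<lambda>_. M) c" using c_flip[of n] by (simp add: flip_def)
    then have "c = (\<lambda>_. M)" using lex_le_const_M[OF c(2)] lex_le_antisym by blast
    then show False using fin M_bounds(3) by (simp add: infinite_seq_def)
  qed
  have "quasigreedy_seq c"
    using quasigreedy_seqI[OF c(2) c_inf vc c(2) c_inf] c_tail by blast
  then have "c = a1" using quasi_greedy_val vc by metis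
  then show ?thesis using that[of "f \<circ> r"] c(1) f_tail f_flip by simp
qed

text \<open>
  The only consequence of \<open>q \<in> closure univoque_bases\<close> that the remaining argument uses. A limit
  argument alone would yield the weak inequality.
\<close>

lemma closure_univoque_bases_strict:
  assumes "q \<in> closure univoque_bases" "0 < a1 n"
  shows "less_fun (flip M (tail (Suc n) a1)) a1"
proof (cases "q = real_of_int \<lceil>q\<rceil>")
  case True
  have "a1 = (\<lambda>_. M)" by (rule a1_integer[OF True])
  then show ?thesis using M_bounds(3) by (auto simp: less_fun_def)
next
  case False
  then obtain f where f: "converges_to f a1"
    "\<And>k n. lex_le (tail n (f k)) (f k)"
    "\<And>k n. 0 < f k n \<Longrightarrow> less_fun (flip M (tail (Suc n) (f k))) (f k)"
    using univoque_approximation[OF assms(1)] by blast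
  have "lex_le (flip M (tail (Suc n) a1)) a1"
  proof (rule converges_to_lex_le[OF converges_to_flip[OF converges_to_tail[OF f(1)]] f(1)])
    show "\<forall>\<^sub>F k in sequentially. lex_le (flip M (tail (Suc n) (f k))) (f k)"
      using converges_toD[OF f(1), of n]
      by (rule eventually_mono) (use assms(2) f(3) in \<open>auto simp: lex_le_def\<close>)
  qed
  moreover have "flip M (tail (Suc n) a1) \<noteq> a1"
  proof
    assume eq: "flip M (tail (Suc n) a1) = a1"
    obtain k where k: "\<forall>i<2 * Suc n. f k i = a1 i"
      using f(1) eventually_happens'[OF sequentially_bot] unfolding converges_to_def by blast
    then have "0 < f k n" using assms(2) by simp
    then show False
      using no_antiperiodic_approximation[OF a1_digits eq, of "f k"] k f(2,3) by blast
  qed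
  ultimately show ?thesis by (simp add: lex_le_def)
qed

end

section \<open>Limit points of \<open>V_set q - univoque_set q\<close>\<close>

text \<open>
  A base in the closure of \<open>univoque_bases\<close>.
\<close>

locale closure_base = base +
  assumes q_closure: "q \<in> closure univoque_bases"
begin

lemmas a1_flip_less = closure_univoque_bases_strict[OF q_closure]

lemma not_meets_both:
  assumes "digits M c" "meets_upper c m" "meets_lower c n"
  shows False
proof -
  have up: "tail (Suc m) c = a1" "c m < M" and low: "flip M (tail (Suc n) c) = a1" "0 < c n"
    using assms by (auto simp: meets_upper_def meets_lower_def)
  have low': "tail (Suc n) c = flip M a1" using low(1) assms(1) by (metis digits_tail flip_flip)
  consider "m < n" | "m = n" | "n < m" by linarith
  then show False
  proof cases
    case 1
    then obtain i where i: "n = Suc m + i" using less_iff_Suc_add by auto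
    have "a1 i = c n" using fun_cong[OF up(1), of i] by (simp add: i)
    moreover have "tail (Suc i) a1 = tail (Suc n) c" by (simp add: i flip: up(1))
    ultimately show False using a1_flip_less[of i] low less_fun_irrefl[of a1] by simp
  next
    case 2
    then show False using up low a1_0 M_bounds(3) by (metis diff_self_eq_0 flip_apply not_one_le_zero)
  next
    case 3
    then obtain i where i: "m = Suc n + i" using less_iff_Suc_add by auto
    have "M - c m = a1 i" using fun_cong[OF low(1), of i] by (simp add: i)
    then have "0 < a1 i" using up(2) by simp
    moreover have "tail (Suc i) a1 = flip M (tail (Suc m) c)" by (simp add: i flip: low(1))
    ultimately show False using a1_flip_less[of i] up(1) less_fun_irrefl assms(1)
      by (metis digits_tail flip_flip)
  qed
qed

text \<open>
  The positions at which a sequence may be cut: \<open>good c n\<close> holds if \<open>c n\<close> is positive and, for each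
  \<open>i < n\<close> at which the lower condition is imposed, the strict inequality between \<open>flip M (tail (Suc i) c)\<close> and \<open>a1\<close> is
  already decided by the digits of \<open>c\<close> up to position \<open>n\<close>.
\<close>

definition good :: "(nat \<Rightarrow> nat) \<Rightarrow> nat \<Rightarrow> bool" where
  "good c n \<longleftrightarrow> 0 < c n \<and>
     (\<forall>i<n. 0 < c i \<longrightarrow> (\<exists>k. Suc i + k \<le> n \<and> M - c (Suc i + k) < a1 k \<and>
        (\<forall>j<k. M - c (Suc i + j) = a1 j)))"

text \<open>
  Given a position \<open>m\<close> with \<open>0 < c m\<close> that is not good, let \<open>i\<close> be the least index violating the condition.
  The position \<open>n > m\<close> at which the inequality for \<open>i\<close> is decided is good: indices below \<open>i\<close> were decided
  by \<open>m\<close> already, and an undecided index between \<open>i\<close> and \<open>n\<close> would produce a shift of \<open>a1\<close> larger than \<open>a1\<close>.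
\<close>

lemma good_exists:
  assumes "digits M c" "infinite_seq c"
    and strict: "\<And>n. 0 < c n \<Longrightarrow> less_fun (flip M (tail (Suc n) c)) a1"
  obtains n where "N \<le> n" "good c n"
proof -
  define D where "D = (\<lambda>i k. M - c (Suc i + k) < a1 k \<and> (\<forall>j<k. M - c (Suc i + j) = a1 j))"
  have D_ex: "\<exists>k. D i k" if "0 < c i" for i
    using strict[OF that] by (simp add: less_fun_def D_def)
  have good_alt: "good c n \<longleftrightarrow> 0 < c n \<and> (\<forall>i<n. 0 < c i \<longrightarrow> (\<exists>k. Suc i + k \<le> n \<and> D i k))" for n
    by (simp add: good_def D_def)
  obtain m where m: "N \<le> m" "0 < c m" using infinite_seqD[OF assms(2)] by blast
  show ?thesis
  proof (cases "good c m")
    case True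
    then show ?thesis using m that by blast
  next
    case False
    define bad where "bad = (\<lambda>i. i < m \<and> 0 < c i \<and> \<not> (\<exists>k. Suc i + k \<le> m \<and> D i k))"
    have "\<exists>i. bad i" using False m(2) by (auto simp: good_alt bad_def)
    then obtain i where i: "bad i" "\<And>j. j < i \<Longrightarrow> \<not> bad j"
      using exists_least_iff[of bad] by blast
    obtain k where k: "D i k" using D_ex i(1) bad_def by blast
    define n where "n = Suc i + k"
    have nm: "m < n" using i(1) k unfolding bad_def n_def by (meson not_le)
    have "0 < c n"
      using k digitsD[OF a1_digits, of k] by (auto simp: D_def n_def)
    moreover have "\<exists>k. Suc j + k \<le> n \<and> D j k" if j: "j < n" "0 < c j" for j
    proof -
      consider "j < i" | "j = i" | "i < j" by linarith
      then show ?thesis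
      proof cases
        case 1
        then have "j < m" using i(1) bad_def by simp
        then show ?thesis using i(2)[OF 1] j(2) nm unfolding bad_def by (meson less_imp_le order_trans)
      next
        case 2
        then show ?thesis using k n_def by blast
      next
        case 3
        obtain l where l: "D j l" using D_ex j(2) by blast
        show ?thesis
        proof (cases "Suc j + l \<le> n")
          case False
          define e where "e = j - i"
          have je: "j = i + e" using 3 by (simp add: e_def)
          have ek: "e \<le> k" using j(1) by (simp add: je n_def)
          have kl: "k - e < l" using False ek unfolding je n_def by linarith
          \<comment> \<open>otherwise the comparisons started at \<open>i\<close> and at \<open>j\<close> contradict \<open>tail_a1_le\<close>\<close>
          have "less_fun a1 (tail e a1)"
            unfolding less_fun_def
          proof (intro exI conjI allI impI)
            have "M - c (Suc j + (k - e)) = a1 (k - e)"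
              using l kl by (simp add: D_def)
            moreover have "Suc j + (k - e) = Suc i + k" using ek by (simp add: je)
            ultimately show "a1 (k - e) < tail e a1 (k - e)" using k ek by (simp add: D_def)
          next
            fix t assume t: "t < k - e"
            have "M - c (Suc j + t) = a1 t"
              using l kl t by (simp add: D_def)
            moreover have "M - c (Suc i + (e + t)) = a1 (e + t)" using k t by (simp add: D_def)
            ultimately show "a1 t = tail e a1 t" by (simp add: je add.assoc)
          qed
          then show ?thesis using tail_a1_le lex_le_iff_not_less by blast
        qed (use l in blast)
      qed
    qed
    ultimately have "good c n" by (simp add: good_alt)
    then show ?thesis using that m(1) nm by (meson less_imp_le order_trans)
  qed
qed

text \<open>
  The first \<open>n\<close> digits of \<open>c\<close>, then \<open>c n - 1\<close>, then \<open>a1\<close>: the quasi-greedy way of writing the finite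
  sequence that ends with the digit \<open>c n\<close>. The subtraction is only used for \<open>0 < c n\<close>.
\<close>

definition cut :: "(nat \<Rightarrow> nat) \<Rightarrow> nat \<Rightarrow> nat \<Rightarrow> nat" where
  "cut c n = (\<lambda>i. if i < n then c i else if i = n then c n - 1 else a1 (i - Suc n))"

lemma cut_tail: "tail (Suc n) (cut c n) = a1"
  by (auto simp: cut_def)

lemma cut_tail_beyond: "n < i \<Longrightarrow> tail (Suc i) (cut c n) = tail (Suc (i - Suc n)) a1"
  by (rule ext) (auto simp: cut_def intro!: arg_cong[of _ _ a1])

lemma cut_admissible:
  assumes "digits M c" "\<And>n. c n < M \<Longrightarrow> lex_le (tail (Suc n) c) a1" "good c n"
  shows "admissible (cut c n)" "meets_upper (cut c n) n"
proof -
  let ?d = "cut c n"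
  have cn: "0 < c n" "c n \<le> M" using assms(1,3) by (auto simp: good_def digits_def)
  show mu: "meets_upper ?d n" using cn cut_tail by (simp add: meets_upper_def cut_def)
  have "?d i \<le> M" for i
    using digitsD[OF assms(1), of i] cn digitsD[OF a1_digits] by (auto simp: cut_def)
  then have dig: "digits M ?d" by (simp add: digits_def)
  have upper: "lex_le (tail (Suc i) ?d) a1" if "?d i < M" for i
  proof -
    consider "i < n" | "i = n" | "n < i" by linarith
    then show ?thesis
    proof cases
      case 1
      have "less_fun (tail (Suc i) ?d) (tail (Suc i) c)"
        unfolding less_fun_def
        by (rule exI[of _ "n - Suc i"]) (use 1 cn in \<open>auto simp: cut_def\<close>)
      moreover have "lex_le (tail (Suc i) c) a1" using 1 that assms(2) by (simp add: cut_def)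
      ultimately show ?thesis by (meson less_lex_le_trans lex_le_def)
    next
      case 2
      then show ?thesis by (simp only: cut_tail) (simp add: lex_le_def)
    next
      case 3
      then show ?thesis using tail_a1_le by (simp only: cut_tail_beyond)
    qed
  qed
  have lower: "lex_le (flip M (tail (Suc i) ?d)) a1" if pos: "0 < ?d i" for i
  proof -
    consider "i < n" | "i = n" | "n < i" by linarith
    then show ?thesis
    proof cases
      case 1
      then have "0 < c i" using pos by (simp add: cut_def)
      then obtain k where k: "Suc i + k \<le> n" "M - c (Suc i + k) < a1 k"
          "\<forall>j<k. M - c (Suc i + j) = a1 j"
        using assms(3) 1 unfolding good_def by blast
      show ?thesis
      proof (cases "Suc i + k = n")
        case False
        then have "less_fun (flip M (tail (Suc i) ?d)) a1"
          unfolding less_fun_def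
          by (intro exI[of _ k]) (use k in \<open>auto simp: cut_def\<close>)
        then show ?thesis by (simp add: lex_le_def)
      next
        case n: True
        \<comment> \<open>the lowered digit may restore equality with \<open>a1\<close> up to \<open>k\<close>; then the tails decide\<close>
        show ?thesis
        proof (rule ccontr)
          assume "\<not> ?thesis"
          then obtain l where l: "a1 l < M - ?d (Suc i + l)" "\<And>j. j < l \<Longrightarrow> a1 j = M - ?d (Suc i + j)"
            unfolding lex_le_iff_not_less less_fun_def by auto
          have "\<not> l < k" using l(1) k(3) n by (auto simp: cut_def)
          moreover have eqk: "M - ?d (Suc i + k) = M - c n + 1"
            using n cn by (auto simp: cut_def)
          then have "l \<noteq> k" using l(1) k(2) n by auto
          ultimately have lk: "k < l" by simp
          have ak: "0 < a1 k" using k(2) by simp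
          have ge: "less_fun (tail (Suc k) a1) (flip M a1)"
            unfolding less_fun_def
          proof (intro exI conjI allI impI)
            have "?d (Suc i + l) = a1 (l - Suc k)" using lk n by (auto simp: cut_def)
            then show "tail (Suc k) a1 (l - Suc k) < flip M a1 (l - Suc k)" using l(1) lk by simp
          next
            fix j assume "j < l - Suc k"
            then have "a1 (Suc k + j) = M - ?d (Suc i + (Suc k + j))" by (intro l(2)) simp
            also have "?d (Suc i + (Suc k + j)) = a1 j" using n by (auto simp: cut_def)
            finally show "tail (Suc k) a1 j = flip M a1 j" by simp
          qed
          \<comment> \<open>the reflection of the strict lower condition for \<open>a1\<close>\<close>
          have "less_fun (flip M a1) (tail (Suc k) a1)"
            using a1_flip_less[OF ak] flip_less[of M "flip M a1" "tail (Suc k) a1"] by simp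
          with ge show False using less_fun_asym by blast
        qed
      qed
    next
      case 2
      have "less_fun (flip M a1) a1"
        unfolding less_fun_def by (rule exI[of _ 0]) (use a1_0 M_bounds(3) in simp)
      then show ?thesis using 2 by (simp only: cut_tail) (simp add: lex_le_def)
    next
      case 3
      then have "0 < a1 (i - Suc n)" using pos by (simp add: cut_def)
      then show ?thesis using a1_flip_less[of "i - Suc n"] 3
        by (simp only: cut_tail_beyond) (simp add: lex_le_def)
    qed
  qed
  show "admissible ?d" using dig upper lower by (simp add: admissible_def)
qed

end

context closure_base
begin

text \<open>
  Cutting \<open>c\<close> at large good positions yields elements of \<open>V_set q - univoque_set q\<close> close to its value.
  Sequences with an equality in the lower condition are excluded here; by \<open>not_meets_both\<close>
  their reflections qualify.
\<close>

lemma accumulation_by_cuts: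
  assumes "admissible c" "infinite_seq c" "\<And>n. \<not> meets_lower c n" "0 < e"
  obtains y where "y \<in> V_set q - univoque_set q" "y \<noteq> v c" "\<bar>y - v c\<bar> < e"
proof -
  note c = admissibleD[OF assms(1)]
  define B where "B = M / (q - 1)"
  have B: "0 \<le> B" using q_gt_1 by (simp add: B_def)
  obtain N where "B / e < q ^ N" using real_arch_pow[OF q_gt_1] by blast
  then have "B < q ^ N * e" by (simp only: pos_divide_less_eq[OF assms(4)])
  then have N: "B / q ^ N < e" using q_gt_1 by (simp add: pos_divide_less_eq mult.commute)
  have "less_fun (flip M (tail (Suc n) c)) a1" if "0 < c n" for n
    using c(3)[OF that] assms(3)[of n] that by (auto simp: meets_lower_def lex_le_def)
  then obtain n where n: "N \<le> n" "good c n" using good_exists[OF c(1) assms(2)] by blast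
  define d where "d = cut c n"
  have d: "admissible d" "meets_upper d n"
    using cut_admissible[OF c(1,2) n(2)] by (simp_all add: d_def)
  have dd: "digits M d" using d(1) admissibleD(1) by blast
  have agree: "d j = c j" if "j < n" for j using that by (simp add: d_def cut_def)
  have "\<bar>v d - v c\<bar> \<le> B / q ^ n" unfolding B_def by (rule val_close[OF dd c(1) agree])
  also have "\<dots> \<le> B / q ^ N"
    using q_gt_1 n(1) B by (intro divide_left_mono power_increasing) auto
  finally have close: "\<bar>v d - v c\<bar> < e" using N by simp
  have dn: "real (d n) = real (c n) - 1" using n(2) by (simp add: d_def cut_def good_def)
  have "v (tail (Suc n) d) = 1" using d(2) quasigreedy_a1(2) by (simp add: meets_upper_def)
  then have "v d - v c = - v (tail (Suc n) c) / q ^ Suc n"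
    by (subst val_split[OF dd c(1) agree]) (auto simp: dn)
  moreover have "v (tail (Suc n) c) > 0" using c(1) assms(2) by (intro val_pos_infinite) auto
  ultimately have "v d \<noteq> v c" using q_gt_1 by auto
  moreover have "v d \<in> V_set q - univoque_set q" using d V_minus_univoque by blast
  ultimately show ?thesis using close that by blast
qed

text \<open>
  The number \<open>0\<close> is approached by the values of the sequences \<open>0\<^sup>n a1\<close>, since \<open>0\<^sup>\<infinity>\<close> has no position at
  which it could be cut.
\<close>

lemma zeros_a1_admissible:
  defines "z \<equiv> \<lambda>n i. if i < Suc n then 0 else a1 (i - Suc n)"
  shows "admissible (z n)" "meets_upper (z n) n"
proof -
  have tl: "tail (Suc n) (z n) = a1" by (auto simp: z_def)
  have tl2: "tail (Suc i) (z n) = tail (Suc (i - Suc n)) a1" if "n < i" for i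
    using that unfolding z_def by (intro ext) (auto intro!: arg_cong[of _ _ a1])
  show "meets_upper (z n) n" using tl M_bounds(3) by (simp add: meets_upper_def z_def)
  have dig: "digits M (z n)" using digitsD[OF a1_digits] by (simp add: digits_def z_def)
  have "lex_le (tail (Suc i) (z n)) a1" for i
  proof -
    consider "i < n" | "i = n" | "n < i" by linarith
    then show ?thesis
    proof cases
      case 1
      then have "less_fun (tail (Suc i) (z n)) a1"
        unfolding less_fun_def
        by (intro exI[of _ 0]) (use a1_0 M_bounds(3) in \<open>simp add: z_def\<close>)
      then show ?thesis by (simp add: lex_le_def)
    next
      case 2
      then show ?thesis by (simp only: tl) (simp add: lex_le_def)
    next
      case 3
      then show ?thesis using tail_a1_le by (simp only: tl2)
    qed
  qed
  moreover have "lex_le (flip M (tail (Suc i) (z n))) a1" if "0 < z n i" for i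
  proof -
    have ni: "n < i" "0 < a1 (i - Suc n)" using that by (auto simp: z_def split: if_splits)
    then show ?thesis using a1_flip_less[of "i - Suc n"]
      by (simp only: tl2) (simp add: lex_le_def)
  qed
  ultimately show "admissible (z n)" using dig by (simp add: admissible_def)
qed

lemma accumulation_at_zero:
  assumes "0 < e"
  obtains y where "y \<in> V_set q - univoque_set q" "y \<noteq> 0" "\<bar>y\<bar> < e"
proof -
  obtain N where N: "1 / e < q ^ N" using real_arch_pow[OF q_gt_1] by blast
  define z where "z = (\<lambda>i. if i < Suc N then 0 else a1 (i - Suc N))"
  have z: "admissible z" "meets_upper z N" using zeros_a1_admissible[of N] by (simp_all add: z_def)
  have dz: "digits M z" using z(1) admissibleD(1) by blast
  have "tail (Suc N) z = a1" by (auto simp: z_def)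
  then have "v z = (\<Sum>i<Suc N. z i / q ^ Suc i) + 1 / q ^ Suc N"
    using val_prefix[OF dz, of "Suc N"] quasigreedy_a1(2) by simp
  also have "(\<Sum>i<Suc N. z i / q ^ Suc i) = 0" by (intro sum.neutral) (simp add: z_def)
  finally have vz: "v z = 1 / q ^ Suc N" by simp
  have "q ^ N \<le> q ^ Suc N" using q_gt_1 by (intro power_increasing) auto
  then have "1 / e < q ^ Suc N" using N by linarith
  then have "v z < e" unfolding vz using assms q_gt_1 by (simp add: field_simps)
  moreover have "0 < v z" unfolding vz using q_gt_1 by simp
  moreover have "v z \<in> V_set q - univoque_set q" using z V_minus_univoque by blast
  ultimately show ?thesis using that[of "v z"] by simp
qed

lemma islimpt_V_minus_univoque:
  assumes "x \<in> V_set q"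
  shows "x islimpt (V_set q - univoque_set q)"
  unfolding islimpt_approachable
proof (intro allI impI)
  fix e :: real assume e: "0 < e"
  have "\<exists>y \<in> V_set q - univoque_set q. y \<noteq> x \<and> \<bar>y - x\<bar> < e"
  proof (cases "x = 0")
    case True
    obtain y where "y \<in> V_set q - univoque_set q" "y \<noteq> 0" "\<bar>y\<bar> < e"
      using accumulation_at_zero[OF e] by blast
    then show ?thesis using True by (intro bexI[of _ y]) auto
  next
    case False
    then obtain c where c: "admissible c" "infinite_seq c" "v c = x" using V_set_nonzero assms by blast
    note cd = admissibleD(1)[OF c(1)]
    show ?thesis
    proof (cases "\<exists>n. meets_lower c n")
      case False
      then show ?thesis using accumulation_by_cuts[OF c(1,2) _ e] c(3) by blast
    next
      case True
      then obtain n where n: "meets_lower c n" by blast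
      have no: "\<not> meets_lower (flip M c) k" for k
        using not_meets_both[OF cd _ n] meets_lower_flip[OF cd] by blast
      have "tail (Suc n) (flip M c) = a1" using n by (simp add: meets_lower_def)
      then have "infinite_seq (flip M c)" using infinite_seq_tail a1_infinite by metis
      then obtain y where y: "y \<in> V_set q - univoque_set q" "y \<noteq> v (flip M c)" "\<bar>y - v (flip M c)\<bar> < e"
        using accumulation_by_cuts[OF admissible_flip[OF c(1)] _ no e] by blast
      then obtain d m where d: "admissible d" "v d = y" "meets_upper d m \<or> meets_lower d m"
        using V_minus_univoque by auto
      have dd: "digits M d" using d(1) admissibleD(1) by blast
      have "admissible (flip M d)" "meets_upper (flip M d) m \<or> meets_lower (flip M d) m"
        using d admissible_flip meets_upper_flip[OF dd] meets_lower_flip[OF dd] by blast+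
      then have "v (flip M d) \<in> V_set q - univoque_set q" using V_minus_univoque by blast
      moreover have "v (flip M d) - x = v (flip M c) - y"
        using val_flip[OF dd] val_flip[OF cd] c(3) d(2) by simp
      ultimately show ?thesis using y(2,3) by (intro bexI[of _ "v (flip M d)"]) auto
    qed
  qed
  then show "\<exists>y \<in> V_set q - univoque_set q. y \<noteq> x \<and> dist y x < e"
    by (simp add: dist_real_def)
qed

section \<open>Cardinalities and the closure of \<open>univoque_set q\<close>\<close>

text \<open>
  A sequence with an equality is determined by a finite prefix and by which of the two tails
  \<open>a1\<close> and \<open>flip M a1\<close> follows it.
\<close>

lemma countable_V_minus_univoque: "countable (V_set q - univoque_set q)"
proof -
  define g where "g = (\<lambda>(l, b). v (\<lambda>i. if i < length l then l ! i
                     else (if b then a1 else flip M a1) (i - length l)))"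
  have "V_set q - univoque_set q \<subseteq> range g"
  proof
    fix x assume "x \<in> V_set q - univoque_set q"
    then obtain c n where c: "admissible c" "v c = x" "meets_upper c n \<or> meets_lower c n"
      using V_minus_univoque by auto
    define b where "b = meets_upper c n"
    have tl: "tail (Suc n) c = (if b then a1 else flip M a1)"
    proof (cases b)
      case True
      then show ?thesis by (simp add: b_def meets_upper_def)
    next
      case False
      then have "flip M (tail (Suc n) c) = a1" using c(3) by (simp add: b_def meets_lower_def)
      then show ?thesis using False flip_flip[OF digits_tail[OF admissibleD(1)[OF c(1)]]] by metis
    qed
    have "(if b then a1 else flip M a1) (i - Suc n) = c i" if "\<not> i < Suc n" for i
      using that by (simp flip: tl del: if_split)
    then have "(\<lambda>i. if i < Suc n then map c [0..<Suc n] ! i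
                 else (if b then a1 else flip M a1) (i - Suc n)) = c"
      by (auto simp del: upt_Suc)
    then have "g (map c [0..<Suc n], b) = x" using c(2)
      by (simp only: g_def prod.case length_map length_upt diff_zero)
    then show "x \<in> range g" by blast
  qed
  then show ?thesis by (rule countable_subset) simp
qed

lemma zero_in_V: "0 \<in> V_set q"
  unfolding V_set_eq using admissible_zero by force

lemma infinite_V_minus_univoque: "infinite (V_set q - univoque_set q)"
  using islimpt_V_minus_univoque[OF zero_in_V] islimpt_finite by blast

text \<open>
  The set \<open>V_set q\<close> is closed without isolated points, so by Baire's theorem it remains dense in
  itself after the countable set \<open>V_set q - univoque_set q\<close> is removed.
\<close>

lemma closure_univoque_set: "closure (univoque_set q) = V_set q"
proof
  show "closure (univoque_set q) \<subseteq> V_set q"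
    using closure_minimal univoque_subset_V closed_V_set by blast
  let ?G = "(\<lambda>y. V_set q - {y}) ` (V_set q - univoque_set q)"
  have "V_set q \<subseteq> closure (\<Inter> ?G)"
  proof (rule Baire[OF closed_V_set])
    show "countable ?G" using countable_V_minus_univoque by blast
  next
    fix T assume "T \<in> ?G"
    then obtain y where y: "y \<in> V_set q" and T: "T = V_set q - {y}" by blast
    have "openin (top_of_set (V_set q)) T" unfolding T by (intro openin_delete openin_subtopology_self)
    moreover have "V_set q \<subseteq> closure T"
    proof
      fix x assume "x \<in> V_set q"
      then have "x islimpt V_set q" using islimpt_V_minus_univoque islimpt_subset by blast
      moreover have "V_set q = insert y T" using y unfolding T by blast
      ultimately have "x islimpt T" by (simp add: islimpt_insert)
      then show "x \<in> closure T" by (simp add: closure_def)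
    qed
    ultimately show "openin (top_of_set (V_set q)) T \<and> V_set q \<subseteq> closure T" by blast
  qed
  moreover have "\<Inter> ?G \<subseteq> univoque_set q"
  proof
    fix x assume x: "x \<in> \<Inter> ?G"
    obtain y where "y \<in> V_set q - univoque_set q"
      using infinite_imp_nonempty[OF infinite_V_minus_univoque] by blast
    then have "x \<in> V_set q" using x by blast
    then show "x \<in> univoque_set q" using x by blast
  qed
  ultimately show "V_set q \<subseteq> closure (univoque_set q)" using closure_mono by blast
qed

lemma raise_neq: "raise c n \<noteq> c"
proof
  assume "raise c n = c"
  then have "raise c n n = c n" by simp
  then show False by (simp add: raise_def)
qed

lemma lower_neq: "meets_lower c n \<Longrightarrow> lower c n \<noteq> c"
proof
  assume "meets_lower c n" "lower c n = c"
  then have "0 < c n" "lower c n n = c n" by (simp_all add: meets_lower_def)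
  then show False by (simp add: lower_def)
qed

text \<open>
  Two positions of equality would make \<open>a1\<close> meet its own upper bound, which is excluded if \<open>1\<close> has
  only one expansion.
\<close>

lemma meets_upper_unique:
  assumes "q \<in> univoque_bases" "meets_upper c m" "meets_upper c n"
  shows "m = n"
proof -
  have False if mn: "m < n" "meets_upper c m" "meets_upper c n" for m n
  proof -
    obtain i where i: "n = Suc m + i" using mn(1) less_iff_Suc_add by auto
    have up: "tail (Suc m) c = a1" "tail (Suc n) c = a1" "c n < M"
      using mn by (auto simp: meets_upper_def)
    have "a1 i = c n" using fun_cong[OF up(1), of i] by (simp add: i)
    moreover have "tail (Suc i) a1 = tail (Suc n) c" by (simp add: i flip: up(1))
    moreover have "strictly_admissible a1" using assms(1) univoque_bases_iff by blast
    ultimately show False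
      using strictly_admissibleD(2)[of a1 i] up less_fun_irrefl[of a1] by simp
  qed
  then show ?thesis using assms by (metis linorder_neqE_nat)
qed

lemma card_expansions:
  assumes "q \<in> univoque_bases" "x \<in> V_set q - univoque_set q"
  shows "card {c. expansion q x c} = 2"
proof -
  obtain c n where c: "admissible c" "v c = x" "meets_upper c n \<or> meets_lower c n"
    using assms(2) V_minus_univoque by auto
  note cd = admissibleD(1)[OF c(1)]
  from c(3) show ?thesis
  proof
    assume n: "meets_upper c n"
    then have "{n. meets_upper c n} = {n}" "{n. meets_lower c n} = {}"
      using meets_upper_unique[OF assms(1)] not_meets_both[OF cd] by blast+
    then have "{d. expansion q x d} = {c, raise c n}"
      using expansions_of_admissible[OF c(1)] c(2) by simp
    then show ?thesis using raise_neq[of c n] by simp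
  next
    assume n: "meets_lower c n"
    then have "{n. meets_lower c n} = {n}" "{n. meets_upper c n} = {}"
      using meets_upper_unique[OF assms(1), of "flip M c"] meets_upper_flip[OF cd]
        not_meets_both[OF cd] by blast+
    then have "{d. expansion q x d} = {c, lower c n}"
      using expansions_of_admissible[OF c(1)] c(2) by simp
    then show ?thesis using lower_neq[OF n] by simp
  qed
qed

lemma inj_raise: "inj (raise c)"
proof (rule injI)
  fix m n assume "raise c m = raise c n"
  then have "raise c m m = raise c n m" "raise c m n = raise c n n" by simp_all
  then show "m = n" by (cases m n rule: linorder_cases) (auto simp: raise_def)
qed

text \<open>
  If \<open>1\<close> has several expansions, then \<open>a1\<close> meets its own upper bound at some \<open>p\<close>, so that it is periodic
  and one equality recurs with period \<open>Suc p\<close>.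
\<close>

lemma meets_upper_infinite:
  assumes "q \<notin> univoque_bases" "meets_upper c n"
  shows "infinite {n. meets_upper c n}"
proof -
  have "admissible a1"
    using tail_a1_le a1_flip_less by (simp add: admissible_def lex_le_def)
  moreover have "\<not> meets_lower a1 n" for n
    using a1_flip_less[of n] less_fun_irrefl[of a1] by (auto simp: meets_lower_def)
  moreover have "\<not> strictly_admissible a1" using assms(1) univoque_bases_iff by blast
  ultimately obtain p where p: "meets_upper a1 p" using strictly_admissible_iff by blast
  have step: "meets_upper c (Suc m + p)" if "meets_upper c m" for m
  proof -
    have up: "tail (Suc m) c = a1" using that by (simp add: meets_upper_def)
    have "c (Suc m + p) = a1 p" by (simp flip: up)
    moreover have "tail (Suc (Suc m + p)) c = tail (Suc p) a1" by (simp flip: up)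
    ultimately show ?thesis using p by (simp add: meets_upper_def)
  qed
  show ?thesis
    unfolding infinite_nat_iff_unbounded_le
  proof
    fix N
    show "\<exists>k\<ge>N. k \<in> {n. meets_upper c n}"
    proof (induction N)
      case 0
      then show ?case using assms(2) by blast
    next
      case (Suc N)
      then obtain k where "k \<ge> N" "meets_upper c k" by blast
      then show ?case using step by (intro exI[of _ "Suc k + p"]) simp
    qed
  qed
qed

lemma expansions_countably_infinite:
  assumes "q \<notin> univoque_bases" "x \<in> V_set q - univoque_set q"
  shows "{c. expansion q x c} \<approx> (UNIV :: nat set)"
proof -
  obtain c n where c: "admissible c" "v c = x" "meets_upper c n \<or> meets_lower c n"
    using assms(2) V_minus_univoque by auto
  note cd = admissibleD(1)[OF c(1)]
  note eq = expansions_of_admissible[OF c(1), unfolded c(2)]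
  have "infinite (raise c ` {n. meets_upper c n}) \<or> infinite (lower c ` {n. meets_lower c n})"
    using c(3)
  proof
    assume "meets_upper c n"
    then show ?thesis
      using meets_upper_infinite[OF assms(1)] inj_on_subset[OF inj_raise]
      by (metis finite_imageD top_greatest)
  next
    assume "meets_lower c n"
    then have "infinite {n. meets_upper (flip M c) n}"
      using meets_upper_infinite[OF assms(1)] meets_upper_flip[OF cd] by blast
    moreover have "{n. meets_upper (flip M c) n} = {n. meets_lower c n}"
      using meets_upper_flip[OF cd] by blast
    ultimately have inf: "infinite {n. meets_lower c n}" by simp
    have "inj_on (lower c) {n. meets_lower c n}"
    proof (rule inj_onI)
      fix m k assume mk: "m \<in> {n. meets_lower c n}" "k \<in> {n. meets_lower c n}" "lower c m = lower c k"
      have "0 < c m" "0 < c k" "c m \<le> M" "c k \<le> M"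
        using mk cd by (auto simp: meets_lower_def digits_def)
      then show "m = k"
        using fun_cong[OF mk(3), of m] fun_cong[OF mk(3), of k]
        by (cases m k rule: linorder_cases) (auto simp: lower_def)
    qed
    then show ?thesis using inf finite_imageD by blast
  qed
  then have "infinite {d. expansion q x d}" unfolding eq by auto
  moreover have "countable {d. expansion q x d}" unfolding eq by simp
  ultimately show ?thesis unfolding eqpoll_def using to_nat_on_infinite by blast
qed

end

theorem theorem1p3:
  fixes q :: real
  assumes "q > 1" and "q \<in> closure univoque_bases"
  shows "closure (univoque_set q) = V_set q
    \<and> (V_set q - univoque_set q \<approx> (UNIV :: nat set) \<and> V_set q \<subseteq> closure (V_set q - univoque_set q))
    \<and> (q \<in> univoque_bases \<longrightarrow> (\<forall>x \<in> V_set q - univoque_set q. card {c. expansion q x c} = 2))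
    \<and> (q \<in> closure univoque_bases - univoque_bases \<longrightarrow>
        (\<forall>x \<in> V_set q - univoque_set q. {c. expansion q x c} \<approx> (UNIV :: nat set)))"
proof -
  interpret closure_base q by standard (use assms in auto)
  have "V_set q - univoque_set q \<approx> (UNIV :: nat set)"
    unfolding eqpoll_def
    using to_nat_on_infinite[OF countable_V_minus_univoque infinite_V_minus_univoque] by blast
  moreover have "V_set q \<subseteq> closure (V_set q - univoque_set q)"
    using islimpt_V_minus_univoque by (auto simp: closure_def)
  ultimately show ?thesis
    using closure_univoque_set card_expansions expansions_countably_infinite by blast
qed

end
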